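(* Let $k,\ell\ge2$, $n=p\ell$ with $p\ge k$ an integer, and $\mathcal D=\mathcal D_n(k,\ell)$. For $s\in\{1,\dots,k\}$ let $T_{\{s\}}=\{1,1+\ell,\dots,1+k\ell\}\setminus\{1+s\ell\}$ and $T_\emptyset=\{1,1+\ell,\dots,1+(k-1)\ell\}$. Then, in the fraction field of $\mathbb C[\mathcal D]$, the ratio $\Delta_{T_{\{s\}}}/\Delta_{T_\emptyset}$ is the constant $$\frac{\Delta_{T_{\{s\}}}}{\Delta_{T_\emptyset}}=\begin{bmatrix}k\\ s\end{bmatrix}_q\Bigg|_{q=e^{2\pi\sqrt{-1}/p}}.$$
   Context: $\mathrm{Gr}(k,n)$ (row spans of $k\times n$ complex matrices) has Plücker coordinates $\Delta_I$. The cyclic shift $\rho$ sends the row span of $(v_1,\dots,v_n)$ (columns) to that of $(v_2,\dots,v_n,(-1)^{k-1}v_1)$. $\mathcal D_n(k,\ell)$ is the connected component of the fixed locus $\mathrm{Gr}(k,n)^{\rho^\ell}$ containing all $\rho^\ell$-fixed points with nonnegative real Plücker coordinates (up to rescaling); it is irreducible and $\mathbb C[\mathcal D]$ is its homogeneous coordinate ring in the Plücker embedding. Indices of Plücker coordinates are read modulo $n$, and a Plücker coordinate with a repeated index is $0$. The symmetric $q$-binomial coefficient is $\begin{bmatrix}k\\ s\end{bmatrix}_q=\frac{[k]!_q}{[s]!_q[k-s]!_q}$ with $[m]_q=\frac{q^{m/2}-q^{-m/2}}{q^{1/2}-q^{-1/2}}$ and $[m]!_q=\prod_{j=1}^m[j]_q$,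 evaluated (as a Laurent polynomial in $q^{1/2}$) with $q^{1/2}=e^{\pi\sqrt{-1}/p}$. *)

theory Defs
  imports
    "HOL-Complex_Analysis.Laurent_Convergence"
    "HOL-Library.Poly_Mapping"
    "HOL-Algebra.QuotRing"
    "Jordan_Normal_Form.DL_Rank"
    "Jordan_Normal_Form.DL_Submatrix"
begin

unbundle no vec_syntax and no fps_syntax

section \<open>The complex Grassmannian\<close>

definition full_rank_mats :: "nat \<Rightarrow> nat \<Rightarrow> complex mat set" where
  "full_rank_mats k n = {A \<in> carrier_mat k n. vec_space.rank k A = k}"

abbreviation row_span :: "complex mat \<Rightarrow> complex Matrix.vec set" where
  "row_span A \<equiv> vec_space.row_space (dim_col A) A"

definition Gr :: "nat \<Rightarrow> nat \<Rightarrow> complex Matrix.vec set set" where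
  "Gr k n = row_span ` full_rank_mats k n"

text \<open>
  Columns of a \<^typ>\<open>complex mat\<close> are counted from 0, Plucker indices from 1. The library's
  \<^const>\<open>submatrix\<close> keeps the selected columns in increasing order.
\<close>

definition plucker :: "complex mat \<Rightarrow> nat set \<Rightarrow> complex" where
  "plucker A I = Determinant.det (submatrix A UNIV ((\<lambda>i. i - 1) ` I))"

definition index_sets :: "nat \<Rightarrow> nat \<Rightarrow> nat set set" where
  "index_sets k n = {I. I \<subseteq> {1..n} \<and> card I = k}"

text \<open>
  The classical topology of the Grassmannian, that is, the quotient topology of the entrywise
  topology on full-rank matrices under \<^term>\<open>row_span\<close>.
\<close>

definition Gr_open :: "nat \<Rightarrow> nat \<Rightarrow> complex Matrix.vec set set \<Rightarrow> bool" where
  "Gr_open k n U \<longleftrightarrow> U \<subseteq> Gr k n \<and>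
    (\<forall>A \<in> full_rank_mats k n. row_span A \<in> U \<longrightarrow>
      (\<exists>e>0. \<forall>B \<in> full_rank_mats k n.
         (\<forall>i<k. \<forall>j<n. dist (B $$ (i, j)) (A $$ (i, j)) < e) \<longrightarrow> row_span B \<in> U))"

definition Gr_topology :: "nat \<Rightarrow> nat \<Rightarrow> complex Matrix.vec set topology" where
  "Gr_topology k n = topology (Gr_open k n)"

lemma istopology_Gr_open: "istopology (Gr_open k n)"
  unfolding istopology_def
proof (intro conjI allI impI)
  fix S T assume S: "Gr_open k n S" and T: "Gr_open k n T"
  show "Gr_open k n (S \<inter> T)"
    unfolding Gr_open_def
  proof (intro conjI ballI impI)
    show "S \<inter> T \<subseteq> Gr k n" using S by (auto simp: Gr_open_def)
    fix A assume A: "A \<in> full_rank_mats k n" "row_span A \<in> S \<inter> T"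
    obtain d where d: "d > 0" "\<forall>B \<in> full_rank_mats k n.
         (\<forall>i<k. \<forall>j<n. dist (B $$ (i, j)) (A $$ (i, j)) < d) \<longrightarrow> row_span B \<in> S"
      using S A by (auto simp: Gr_open_def)
    obtain e where e: "e > 0" "\<forall>B \<in> full_rank_mats k n.
         (\<forall>i<k. \<forall>j<n. dist (B $$ (i, j)) (A $$ (i, j)) < e) \<longrightarrow> row_span B \<in> T"
      using T A by (auto simp: Gr_open_def)
    show "\<exists>e>0. \<forall>B \<in> full_rank_mats k n.
         (\<forall>i<k. \<forall>j<n. dist (B $$ (i, j)) (A $$ (i, j)) < e) \<longrightarrow> row_span B \<in> S \<inter> T"
      using d e by (intro exI[of _ "min d e"]) auto
  qed
next
  fix K assume K: "\<forall>S\<in>K. Gr_open k n S"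
  show "Gr_open k n (\<Union>K)"
    unfolding Gr_open_def
  proof (intro conjI ballI impI)
    show "\<Union>K \<subseteq> Gr k n" using K by (auto simp: Gr_open_def)
    fix A assume A: "A \<in> full_rank_mats k n" "row_span A \<in> \<Union>K"
    then obtain S where S: "S \<in> K" "row_span A \<in> S" by auto
    with K A obtain e where "e > 0" "\<forall>B \<in> full_rank_mats k n.
         (\<forall>i<k. \<forall>j<n. dist (B $$ (i, j)) (A $$ (i, j)) < e) \<longrightarrow> row_span B \<in> S"
      unfolding Gr_open_def by meson
    with S show "\<exists>e>0. \<forall>B \<in> full_rank_mats k n.
         (\<forall>i<k. \<forall>j<n. dist (B $$ (i, j)) (A $$ (i, j)) < e) \<longrightarrow> row_span B \<in> \<Union>K"
      by blast
  qed
qed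

lemma openin_Gr_topology: "openin (Gr_topology k n) = Gr_open k n"
  unfolding Gr_topology_def using istopology_Gr_open by (rule topology_inverse')

lemma topspace_Gr_topology: "topspace (Gr_topology k n) = Gr k n"
proof
  show "topspace (Gr_topology k n) \<subseteq> Gr k n"
    using openin_topspace[of "Gr_topology k n"] by (simp add: openin_Gr_topology Gr_open_def)
  have "Gr_open k n (Gr k n)" by (auto simp: Gr_open_def Gr_def intro: exI[of _ 1])
  then show "Gr k n \<subseteq> topspace (Gr_topology k n)"
    by (simp add: openin_subset openin_Gr_topology)
qed


section \<open>The cyclic shift and the component of the fixed locus\<close>

text \<open>
  The cyclic shift of the columns acts on each row separately, so it acts on subspaces as the
  image under a linear map on row vectors; see \<open>cyclic_shift_row_span\<close>.
\<close>

definition shift_mat :: "complex mat \<Rightarrow> complex mat" where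
  "shift_mat A = mat (dim_row A) (dim_col A)
     (\<lambda>(i, j). if Suc j < dim_col A then A $$ (i, Suc j) else (-1) ^ (dim_row A - 1) * A $$ (i, 0))"

definition shift_vec :: "nat \<Rightarrow> complex Matrix.vec \<Rightarrow> complex Matrix.vec" where
  "shift_vec k v = Matrix.vec (dim_vec v)
     (\<lambda>j. if Suc j < dim_vec v then vec_index v (Suc j) else (-1) ^ (k - 1) * vec_index v 0)"

definition cyclic_shift :: "nat \<Rightarrow> complex Matrix.vec set \<Rightarrow> complex Matrix.vec set" where
  "cyclic_shift k V = shift_vec k ` V"

lemma cyclic_shift_row_span:
  assumes "A \<in> carrier_mat k n"
  shows "cyclic_shift k (row_span A) = row_span (shift_mat A)"
proof -
  have carr: "A \<in> carrier_mat k n" "shift_mat A \<in> carrier_mat k n"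
    using assms by (auto simp: shift_mat_def)
  have shift: "shift_vec k (mult_mat_vec (transpose_mat A) y) = mult_mat_vec (transpose_mat (shift_mat A)) y"
    if "y \<in> carrier_vec k" for y
    using that assms
    by (intro eq_vecI)
      (auto simp: shift_vec_def shift_mat_def scalar_prod_def sum_distrib_left mult.assoc)
  show ?thesis
    unfolding cyclic_shift_def using carr shift
    by (auto simp: vec_space.row_space_eq[OF carr(1)] vec_space.row_space_eq[OF carr(2)]
        intro!: image_eqI[where x = "mult_mat_vec (transpose_mat A) y" for y])
qed

definition fixed_locus :: "nat \<Rightarrow> nat \<Rightarrow> nat \<Rightarrow> complex Matrix.vec set set" where
  "fixed_locus k n l = {V \<in> Gr k n. (cyclic_shift k ^^ l) V = V}"

definition Gr_nonneg :: "nat \<Rightarrow> nat \<Rightarrow> complex Matrix.vec set set" where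
  "Gr_nonneg k n = {V. \<exists>A \<in> full_rank_mats k n. row_span A = V \<and>
     (\<exists>c. c \<noteq> 0 \<and> (\<forall>I \<in> index_sets k n. c * plucker A I \<in> \<real>\<^sub>\<ge>\<^sub>0))}"

text \<open>
  Nonnegative fixed points exist and components are disjoint, so at most one \<open>D\<close> satisfies this.
\<close>

definition is_nonneg_component ::
    "nat \<Rightarrow> nat \<Rightarrow> nat \<Rightarrow> complex Matrix.vec set set \<Rightarrow> bool" where
  "is_nonneg_component n k l D \<longleftrightarrow>
     D \<in> connected_components_of (subtopology (Gr_topology k n) (fixed_locus k n l)) \<and>
     fixed_locus k n l \<inter> Gr_nonneg k n \<subseteq> D"


section \<open>The homogeneous coordinate ring\<close>

text \<open>Polynomials over the complex numbers in variables \<open>x\<^sub>I\<close> indexed by sets \<open>I\<close> of naturals.\<close>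

type_synonym plucker_poly = "(nat set \<Rightarrow>\<^sub>0 nat) \<Rightarrow>\<^sub>0 complex"

definition plucker_poly_ring :: "nat \<Rightarrow> nat \<Rightarrow> plucker_poly ring" where
  "plucker_poly_ring k n =
     \<lparr>carrier = {f. \<forall>m \<in> Poly_Mapping.keys f. Poly_Mapping.keys m \<subseteq> index_sets k n},
      mult = (*), one = 1, zero = 0, add = (+)\<rparr>"

definition const_poly :: "complex \<Rightarrow> plucker_poly" where
  "const_poly c = Poly_Mapping.single 0 c"

definition eval_poly :: "(nat set \<Rightarrow> complex) \<Rightarrow> plucker_poly \<Rightarrow> complex" where
  "eval_poly x f = (\<Sum>m \<in> Poly_Mapping.keys f. Poly_Mapping.lookup f m *
     (\<Prod>I \<in> Poly_Mapping.keys m. x I ^ Poly_Mapping.lookup m I))"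

text \<open>
  The index set \<open>T\<close> consists of positive integers, which are reduced modulo \<open>n\<close> to \<open>{1..n}\<close>.
\<close>

definition plucker_var :: "nat \<Rightarrow> nat set \<Rightarrow> plucker_poly" where
  "plucker_var n T = (let r = (\<lambda>i. (i - 1) mod n + 1) in
     if inj_on r T then Poly_Mapping.single (Poly_Mapping.single (r ` T) 1) 1 else 0)"

text \<open>
  The polynomials vanishing at every vector of homogeneous Plucker coordinates of every point
  of \<open>D\<close>: changing the matrix \<open>A\<close> with a given row span rescales all Plucker coordinates by a
  common factor, and every nonzero factor occurs when \<open>k > 0\<close>.
\<close>

definition vanishing_ideal :: "nat \<Rightarrow> nat \<Rightarrow> complex Matrix.vec set set \<Rightarrow> plucker_poly set" where
  "vanishing_ideal k n D = {f \<in> carrier (plucker_poly_ring k n).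
     \<forall>A \<in> full_rank_mats k n. row_span A \<in> D \<longrightarrow> eval_poly (plucker A) f = 0}"

definition coord_ring :: "nat \<Rightarrow> nat \<Rightarrow> complex Matrix.vec set set \<Rightarrow> plucker_poly set ring" where
  "coord_ring k n D = plucker_poly_ring k n Quot vanishing_ideal k n D"

definition coord_class ::
    "nat \<Rightarrow> nat \<Rightarrow> complex Matrix.vec set set \<Rightarrow> plucker_poly \<Rightarrow> plucker_poly set" where
  "coord_class k n D f = vanishing_ideal k n D +>\<^bsub>plucker_poly_ring k n\<^esub> f"


section \<open>The fraction field of a domain\<close>

definition frac_rel :: "('a, 'b) ring_scheme \<Rightarrow> (('a \<times> 'a) \<times> ('a \<times> 'a)) set" where
  "frac_rel R = {((a, b), (c, d)). a \<in> carrier R \<and> b \<in> carrier R - {\<zero>\<^bsub>R\<^esub>} \<and>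
     c \<in> carrier R \<and> d \<in> carrier R - {\<zero>\<^bsub>R\<^esub>} \<and> a \<otimes>\<^bsub>R\<^esub> d = c \<otimes>\<^bsub>R\<^esub> b}"

definition ring_frac :: "('a, 'b) ring_scheme \<Rightarrow> 'a \<Rightarrow> 'a \<Rightarrow> ('a \<times> 'a) set" where
  "ring_frac R a b = frac_rel R `` {(a, b)}"

definition fraction_field :: "('a, 'b) ring_scheme \<Rightarrow> ('a \<times> 'a) set ring" where
  "fraction_field R =
     \<lparr>carrier = (carrier R \<times> (carrier R - {\<zero>\<^bsub>R\<^esub>})) // frac_rel R,
      mult = (\<lambda>X Y. \<Union>(a, b)\<in>X. \<Union>(c, d)\<in>Y. ring_frac R (a \<otimes>\<^bsub>R\<^esub> c) (b \<otimes>\<^bsub>R\<^esub> d)),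
      one = ring_frac R \<one>\<^bsub>R\<^esub> \<one>\<^bsub>R\<^esub>,
      zero = ring_frac R \<zero>\<^bsub>R\<^esub> \<one>\<^bsub>R\<^esub>,
      add = (\<lambda>X Y. \<Union>(a, b)\<in>X. \<Union>(c, d)\<in>Y.
        ring_frac R (a \<otimes>\<^bsub>R\<^esub> d \<oplus>\<^bsub>R\<^esub> c \<otimes>\<^bsub>R\<^esub> b) (b \<otimes>\<^bsub>R\<^esub> d))\<rparr>"

definition to_frac :: "('a, 'b) ring_scheme \<Rightarrow> 'a \<Rightarrow> ('a \<times> 'a) set" where
  "to_frac R a = ring_frac R a \<one>\<^bsub>R\<^esub>"

context domain
begin

lemma equiv_frac_rel: "equiv (carrier R \<times> (carrier R - {\<zero>})) (frac_rel R)" (is "equiv ?Q _")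
proof (rule equivI)
  show "frac_rel R \<subseteq> ?Q \<times> ?Q" by (auto simp: frac_rel_def)
  show "refl_on ?Q (frac_rel R)" by (auto simp: refl_on_def frac_rel_def)
  show "sym (frac_rel R)" by (auto simp: sym_def frac_rel_def)
  show "trans (frac_rel R)"
  proof (rule transI, clarify)
    fix a b c d e f
    assume 1: "((a, b), (c, d)) \<in> frac_rel R" and 2: "((c, d), (e, f)) \<in> frac_rel R"
    then have car: "a \<in> carrier R" "b \<in> carrier R" "c \<in> carrier R" "d \<in> carrier R"
        "e \<in> carrier R" "f \<in> carrier R" "b \<noteq> \<zero>" "d \<noteq> \<zero>" "f \<noteq> \<zero>"
      and ad: "a \<otimes> d = c \<otimes> b" and cf: "c \<otimes> f = e \<otimes> d"
      by (auto simp: frac_rel_def)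
    have "d \<otimes> (a \<otimes> f) = (a \<otimes> d) \<otimes> f" using car by (simp add: m_ac)
    also have "\<dots> = (c \<otimes> f) \<otimes> b" unfolding ad using car by (simp add: m_ac)
    also have "\<dots> = d \<otimes> (e \<otimes> b)" unfolding cf using car by (simp add: m_ac)
    finally have "a \<otimes> f = e \<otimes> b" using car m_lcancel[of d] by simp
    with car show "((a, b), (e, f)) \<in> frac_rel R" by (auto simp: frac_rel_def)
  qed
qed

lemma frac_eq_iff:
  assumes "a \<in> carrier R" "b \<in> carrier R - {\<zero>}" "c \<in> carrier R" "d \<in> carrier R - {\<zero>}"
  shows "ring_frac R a b = ring_frac R c d \<longleftrightarrow> a \<otimes> d = c \<otimes> b"
proof -
  have "ring_frac R a b = ring_frac R c d \<longleftrightarrow> ((a, b), (c, d)) \<in> frac_rel R"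
    unfolding ring_frac_def using assms by (intro eq_equiv_class_iff[OF equiv_frac_rel]) auto
  then show ?thesis using assms by (auto simp: frac_rel_def)
qed

lemma frac_cases:
  assumes "X \<in> carrier (fraction_field R)"
  obtains a b where "a \<in> carrier R" "b \<in> carrier R - {\<zero>}" "X = ring_frac R a b"
  using assms by (auto simp: fraction_field_def ring_frac_def elim!: quotientE)

lemma frac_closed:
  "a \<in> carrier R \<Longrightarrow> b \<in> carrier R - {\<zero>} \<Longrightarrow> ring_frac R a b \<in> carrier (fraction_field R)"
  by (auto simp: fraction_field_def ring_frac_def intro: quotientI)

lemma UN_pairs_eq:
  assumes "(a, b) \<in> X" "(c, d) \<in> Y"
    and "\<And>a b c d. (a, b) \<in> X \<Longrightarrow> (c, d) \<in> Y \<Longrightarrow> f a b c d = Z"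
  shows "(\<Union>(a, b)\<in>X. \<Union>(c, d)\<in>Y. f a b c d) = Z"
proof -
  have "(\<Union>(a, b)\<in>X. \<Union>(c, d)\<in>Y. f a b c d) = (\<Union>x\<in>X. \<Union>y\<in>Y. Z)"
    using assms(3) by (intro SUP_cong refl) (auto split: prod.splits)
  then show ?thesis using assms(1,2) by auto
qed

lemma frac_mult:
  assumes "a \<in> carrier R" "b \<in> carrier R - {\<zero>}" "c \<in> carrier R" "d \<in> carrier R - {\<zero>}"
  shows "ring_frac R a b \<otimes>\<^bsub>fraction_field R\<^esub> ring_frac R c d = ring_frac R (a \<otimes> c) (b \<otimes> d)"
proof -
  have eq: "ring_frac R (a' \<otimes> c') (b' \<otimes> d') = ring_frac R (a \<otimes> c) (b \<otimes> d)"
    if ab: "((a, b), (a', b')) \<in> frac_rel R" and cd: "((c, d), (c', d')) \<in> frac_rel R"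
    for a' b' c' d'
  proof -
    have car: "a' \<in> carrier R" "b' \<in> carrier R" "c' \<in> carrier R" "d' \<in> carrier R"
        "b' \<noteq> \<zero>" "d' \<noteq> \<zero>" and e: "a \<otimes> b' = a' \<otimes> b" "c \<otimes> d' = c' \<otimes> d"
      using ab cd by (auto simp: frac_rel_def)
    have "(a' \<otimes> c') \<otimes> (b \<otimes> d) = (a' \<otimes> b) \<otimes> (c' \<otimes> d)"
      using car assms by (simp add: m_ac)
    also have "\<dots> = (a \<otimes> c) \<otimes> (b' \<otimes> d')"
      unfolding e[symmetric] using car assms by (simp add: m_ac)
    finally show ?thesis using car assms by (subst frac_eq_iff) (auto simp: integral_iff)
  qed
  have "(a, b) \<in> ring_frac R a b" "(c, d) \<in> ring_frac R c d"
    using assms by (auto simp: ring_frac_def frac_rel_def)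
  then show ?thesis
    unfolding fraction_field_def ring.simps monoid.simps
    by (rule UN_pairs_eq) (rule eq; simp add: ring_frac_def)
qed

lemma frac_add:
  assumes "a \<in> carrier R" "b \<in> carrier R - {\<zero>}" "c \<in> carrier R" "d \<in> carrier R - {\<zero>}"
  shows "ring_frac R a b \<oplus>\<^bsub>fraction_field R\<^esub> ring_frac R c d = ring_frac R (a \<otimes> d \<oplus> c \<otimes> b) (b \<otimes> d)"
proof -
  have eq: "ring_frac R (a' \<otimes> d' \<oplus> c' \<otimes> b') (b' \<otimes> d') = ring_frac R (a \<otimes> d \<oplus> c \<otimes> b) (b \<otimes> d)"
    if ab: "((a, b), (a', b')) \<in> frac_rel R" and cd: "((c, d), (c', d')) \<in> frac_rel R"
    for a' b' c' d'
  proof -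
    have car: "a' \<in> carrier R" "b' \<in> carrier R" "c' \<in> carrier R" "d' \<in> carrier R"
        "b' \<noteq> \<zero>" "d' \<noteq> \<zero>" and e: "a \<otimes> b' = a' \<otimes> b" "c \<otimes> d' = c' \<otimes> d"
      using ab cd by (auto simp: frac_rel_def)
    have "(a' \<otimes> d' \<oplus> c' \<otimes> b') \<otimes> (b \<otimes> d) =
        (a' \<otimes> b) \<otimes> (d' \<otimes> d) \<oplus> (c' \<otimes> d) \<otimes> (b' \<otimes> b)"
      using car assms by (simp add: l_distr r_distr m_ac)
    also have "\<dots> = (a \<otimes> d \<oplus> c \<otimes> b) \<otimes> (b' \<otimes> d')"
      unfolding e[symmetric] using car assms by (simp add: l_distr r_distr m_ac)
    finally show ?thesis using car assms by (subst frac_eq_iff) (auto simp: integral_iff)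
  qed
  have "(a, b) \<in> ring_frac R a b" "(c, d) \<in> ring_frac R c d"
    using assms by (auto simp: ring_frac_def frac_rel_def)
  then show ?thesis
    unfolding fraction_field_def ring.simps monoid.simps
    by (rule UN_pairs_eq) (rule eq; simp add: ring_frac_def)
qed

lemma fraction_field_one_zero:
  "\<one>\<^bsub>fraction_field R\<^esub> = ring_frac R \<one> \<one>" "\<zero>\<^bsub>fraction_field R\<^esub> = ring_frac R \<zero> \<one>"
  by (simp_all add: fraction_field_def)

lemma field_fraction_field: "field (fraction_field R)"
proof -
  let ?F = "fraction_field R"
  note simps = frac_mult frac_add frac_eq_iff fraction_field_one_zero frac_closed integral_iff
  have "abelian_group ?F"
  proof (rule abelian_groupI)
    fix x y assume "x \<in> carrier ?F" "y \<in> carrier ?F"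
    then show "x \<oplus>\<^bsub>?F\<^esub> y \<in> carrier ?F" "x \<oplus>\<^bsub>?F\<^esub> y = y \<oplus>\<^bsub>?F\<^esub> x"
      by (elim frac_cases; simp add: simps; simp add: a_comm m_comm)+
  next
    fix x y z assume "x \<in> carrier ?F" "y \<in> carrier ?F" "z \<in> carrier ?F"
    then show "x \<oplus>\<^bsub>?F\<^esub> y \<oplus>\<^bsub>?F\<^esub> z = x \<oplus>\<^bsub>?F\<^esub> (y \<oplus>\<^bsub>?F\<^esub> z)"
      by (elim frac_cases) (simp add: simps l_distr r_distr a_ac m_ac)
  next
    show "\<zero>\<^bsub>?F\<^esub> \<in> carrier ?F" by (simp add: simps)
  next
    fix x assume "x \<in> carrier ?F"
    then obtain a b where x: "a \<in> carrier R" "b \<in> carrier R - {\<zero>}" "x = ring_frac R a b"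
      by (rule frac_cases)
    then show "\<zero>\<^bsub>?F\<^esub> \<oplus>\<^bsub>?F\<^esub> x = x" by (simp add: simps)
    have "ring_frac R (\<ominus> a) b \<oplus>\<^bsub>?F\<^esub> x = \<zero>\<^bsub>?F\<^esub>"
      using x by (simp add: simps l_minus l_neg)
    then show "\<exists>y\<in>carrier ?F. y \<oplus>\<^bsub>?F\<^esub> x = \<zero>\<^bsub>?F\<^esub>"
      using x by (intro bexI[of _ "ring_frac R (\<ominus> a) b"]) (auto simp: simps)
  qed
  moreover have "comm_monoid ?F"
  proof (rule comm_monoidI)
    fix x y assume "x \<in> carrier ?F" "y \<in> carrier ?F"
    then show "x \<otimes>\<^bsub>?F\<^esub> y \<in> carrier ?F" "x \<otimes>\<^bsub>?F\<^esub> y = y \<otimes>\<^bsub>?F\<^esub> x"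
      by (elim frac_cases; simp add: simps m_comm)+
  next
    fix x y z assume "x \<in> carrier ?F" "y \<in> carrier ?F" "z \<in> carrier ?F"
    then show "x \<otimes>\<^bsub>?F\<^esub> y \<otimes>\<^bsub>?F\<^esub> z = x \<otimes>\<^bsub>?F\<^esub> (y \<otimes>\<^bsub>?F\<^esub> z)"
      by (elim frac_cases) (simp add: simps m_ac)
  next
    show "\<one>\<^bsub>?F\<^esub> \<in> carrier ?F" by (simp add: simps)
  next
    fix x assume "x \<in> carrier ?F"
    then show "\<one>\<^bsub>?F\<^esub> \<otimes>\<^bsub>?F\<^esub> x = x" by (elim frac_cases) (simp add: simps)
  qed
  ultimately have cring: "cring ?F"
  proof (rule cringI)
    fix x y z assume "x \<in> carrier ?F" "y \<in> carrier ?F" "z \<in> carrier ?F"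
    then show "(x \<oplus>\<^bsub>?F\<^esub> y) \<otimes>\<^bsub>?F\<^esub> z = x \<otimes>\<^bsub>?F\<^esub> z \<oplus>\<^bsub>?F\<^esub> y \<otimes>\<^bsub>?F\<^esub> z"
      by (elim frac_cases) (simp add: simps l_distr r_distr m_ac)
  qed
  interpret F: cring ?F by (rule cring)
  show ?thesis
  proof (rule F.cring_fieldI2)
    show "\<zero>\<^bsub>?F\<^esub> \<noteq> \<one>\<^bsub>?F\<^esub>" by (simp add: simps)
    fix x assume "x \<in> carrier ?F" and nz: "x \<noteq> \<zero>\<^bsub>?F\<^esub>"
    then obtain a b where x: "a \<in> carrier R" "b \<in> carrier R - {\<zero>}" "x = ring_frac R a b"
      by (metis frac_cases)
    with nz have "a \<noteq> \<zero>" by (auto simp: simps)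
    with x show "\<exists>y\<in>carrier ?F. x \<otimes>\<^bsub>?F\<^esub> y = \<one>\<^bsub>?F\<^esub>"
      by (intro bexI[of _ "ring_frac R b a"]) (auto simp: simps m_comm)
  qed
qed

lemma to_frac_divide:
  assumes "a \<in> carrier R" "b \<in> carrier R - {\<zero>}"
  shows "to_frac R a \<otimes>\<^bsub>fraction_field R\<^esub> inv\<^bsub>fraction_field R\<^esub> (to_frac R b) = ring_frac R a b"
proof -
  interpret F: field "fraction_field R" by (rule field_fraction_field)
  have "inv\<^bsub>fraction_field R\<^esub> (to_frac R b) = ring_frac R \<one> b"
    using assms by (intro F.comm_inv_char)
      (auto simp: to_frac_def frac_mult frac_eq_iff fraction_field_one_zero frac_closed)
  then show ?thesis using assms by (simp add: to_frac_def frac_mult)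
qed

end


section \<open>Symmetric q-binomial coefficients\<close>

text \<open>
  Everything is expressed in \<open>X = q\<^bsup>1/2\<^esup>\<close>. The quotients are taken in the field of formal Laurent
  series in \<open>X\<close>; the q-binomial coefficient is a Laurent polynomial there, so that
  \<^const>\<open>eval_fls\<close> is ordinary evaluation for it at every nonzero argument.
\<close>

definition q_int :: "nat \<Rightarrow> complex fls" where
  "q_int m = (fls_X_intpow (int m) - fls_X_intpow (- int m)) / (fls_X - fls_X_inv)"

definition q_fact :: "nat \<Rightarrow> complex fls" where
  "q_fact m = (\<Prod>j = 1..m. q_int j)"

definition q_binomial :: "nat \<Rightarrow> nat \<Rightarrow> complex fls" where
  "q_binomial k s = q_fact k / (q_fact s * q_fact (k - s))"


section \<open>The index sets\<close>

definition T_empty :: "nat \<Rightarrow> nat \<Rightarrow> nat set" where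
  "T_empty k l = (\<lambda>j. 1 + j * l) ` {0..<k}"

definition T_single :: "nat \<Rightarrow> nat \<Rightarrow> nat \<Rightarrow> nat set" where
  "T_single k l s = (\<lambda>j. 1 + j * l) ` {0..k} - {1 + s * l}"

end

theory Submission
  imports Defs
begin

text \<open>
  Lift a point of the fixed locus to a matrix \<open>A\<close>. The \<open>l\<close>-fold shift acts on the row span with
  eigenvalues among the \<open>p\<close>-th roots of \<open>(-1)\<^bsup>k-1\<^esup>\<close>. For each root \<open>c\<close>, having the eigenvalue \<open>c\<close> is an
  open condition (the projection onto the eigenspace is nonzero) and a closed one (the shift minus
  \<open>c\<close> is singular), so the spectrum is constant on \<open>D\<close>. The cyclically symmetric point spanned by
  the geometric progressions of the \<open>k\<close> \<open>n\<close>-th roots of \<open>(-1)\<^bsup>k-1\<^esup>\<close> closest to 1 is nonnegative, by a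
  Vandermonde determinant; hence on \<open>D\<close> the eigenvalues are the \<open>k\<close> distinct numbers
  \<open>\<omega>\<^bsup>k-1-2a\<^esup>\<close>, \<open>\<omega> = e\<^bsup>\<pi>i/p\<^esup>\<close>. By the symmetric q-binomial theorem they are the roots of
  \<open>\<Sum>\<^sub>s (-1)\<^sup>s B\<^sub>s x\<^sup>s\<close> with \<open>B\<^sub>s\<close> the q-binomial coefficients, which gives a linear relation among the
  columns \<open>1, 1 + l, \<dots>, 1 + k l\<close> of \<open>A\<close>, and Cramer's rule turns it into the ratios of minors.

  Matrices of eigenvectors can be joined by a complex line with finitely many points removed. This
  shows that all of them span points of \<open>D\<close>, and, restricting polynomials to such lines, that the
  vanishing ideal of \<open>D\<close> is prime.
\<close>

section \<open>Polynomials in the Plucker coordinates\<close>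

text \<open>The inner product in \<open>eval_poly\<close>, given a name because evaluation is first
  shown to be multiplicative on single monomials.\<close>

definition eval_monom :: "(nat set \<Rightarrow> complex) \<Rightarrow> (nat set \<Rightarrow>\<^sub>0 nat) \<Rightarrow> complex" where
  "eval_monom x m = (\<Prod>I \<in> Poly_Mapping.keys m. x I ^ Poly_Mapping.lookup m I)"

lemma eval_monom_superset:
  assumes "finite S" "Poly_Mapping.keys m \<subseteq> S"
  shows "eval_monom x m = (\<Prod>I\<in>S. x I ^ Poly_Mapping.lookup m I)"
  unfolding eval_monom_def using assms by (intro prod.mono_neutral_left) (auto simp: not_in_keys_iff_lookup_eq_zero)

lemma eval_monom_add: "eval_monom x (m + m') = eval_monom x m * eval_monom x m'"
proof -
  let ?S = "Poly_Mapping.keys m \<union> Poly_Mapping.keys m'"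
  show ?thesis
    using keys_add[of m m']
      eval_monom_superset[of ?S m x] eval_monom_superset[of ?S m' x] eval_monom_superset[of ?S "m + m'" x]
    by (simp add: lookup_add power_add prod.distrib)
qed

lemma eval_poly_altdef:
  assumes "finite S" "Poly_Mapping.keys f \<subseteq> S"
  shows "eval_poly x f = (\<Sum>m\<in>S. Poly_Mapping.lookup f m * eval_monom x m)"
  unfolding eval_poly_def eval_monom_def[symmetric]
  using assms by (intro sum.mono_neutral_left) (auto simp: not_in_keys_iff_lookup_eq_zero)

lemma eval_poly_keys:
  "eval_poly x f = (\<Sum>m\<in>Poly_Mapping.keys f. Poly_Mapping.lookup f m * eval_monom x m)"
  by (rule eval_poly_altdef) auto

lemma eval_poly_0 [simp]: "eval_poly x 0 = 0"
  by (simp add: eval_poly_def)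

lemma eval_poly_add: "eval_poly x (f + g) = eval_poly x f + eval_poly x g"
proof -
  let ?S = "Poly_Mapping.keys f \<union> Poly_Mapping.keys g"
  show ?thesis
    using keys_add[of f g] eval_poly_altdef[of ?S f x] eval_poly_altdef[of ?S g x] eval_poly_altdef[of ?S "f + g" x]
    by (simp add: lookup_add distrib_right sum.distrib)
qed

lemma eval_poly_uminus: "eval_poly x (- f) = - eval_poly x f"
  using eval_poly_add[of x f "- f"] by (simp add: eq_neg_iff_add_eq_0 add.commute)

lemma eval_poly_sum: "eval_poly x (sum F S) = (\<Sum>i\<in>S. eval_poly x (F i))"
  by (induction S rule: infinite_finite_induct) (auto simp: eval_poly_add)

lemma eval_poly_single: "eval_poly x (Poly_Mapping.single m c) = c * eval_monom x m"
  by (subst eval_poly_altdef[of "{m}"]) auto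

lemma eval_const_poly [simp]: "eval_poly x (const_poly c) = c"
  by (simp add: const_poly_def eval_poly_single eval_monom_def)

lemma eval_poly_1 [simp]: "eval_poly x 1 = 1"
  using eval_const_poly[of x 1] by (simp add: const_poly_def)

lemma poly_mapping_sum_single:
  "(\<Sum>m\<in>Poly_Mapping.keys f. Poly_Mapping.single m (Poly_Mapping.lookup f m)) = f"
  by (rule poly_mapping_eqI)
    (auto simp: lookup_sum lookup_single when_def not_in_keys_iff_lookup_eq_zero)

text \<open>Both factors are written as sums of their terms, which reduces the claim to
  \<open>eval_monom_add\<close>.\<close>

lemma eval_poly_mult: "eval_poly x (f * g) = eval_poly x f * eval_poly x g"
proof -
  let ?s = "\<lambda>f m. Poly_Mapping.single m (Poly_Mapping.lookup f m)"
  have "f * g = (\<Sum>m\<in>Poly_Mapping.keys f. ?s f m) * (\<Sum>m\<in>Poly_Mapping.keys g. ?s g m)"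
    by (simp only: poly_mapping_sum_single)
  then have "eval_poly x (f * g) = (\<Sum>m\<in>Poly_Mapping.keys f. \<Sum>m'\<in>Poly_Mapping.keys g.
      (Poly_Mapping.lookup f m * eval_monom x m) * (Poly_Mapping.lookup g m' * eval_monom x m'))"
    by (simp add: sum_product mult_single eval_poly_sum eval_poly_single eval_monom_add mult_ac)
  then show ?thesis
    by (simp only: sum_product eval_poly_keys)
qed

section \<open>The polynomial ring and the vanishing ideal\<close>

lemma keys_uminus: "Poly_Mapping.keys (- f :: plucker_poly) = Poly_Mapping.keys f"
  by (simp add: Set.set_eq_iff in_keys_iff)

lemma carrier_plucker_poly_ring:
  "f \<in> carrier (plucker_poly_ring k n) \<longleftrightarrow> (\<forall>m \<in> Poly_Mapping.keys f. Poly_Mapping.keys m \<subseteq> index_sets k n)"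
  and plucker_poly_ring_ops:
    "f \<oplus>\<^bsub>plucker_poly_ring k n\<^esub> g = f + g" "f \<otimes>\<^bsub>plucker_poly_ring k n\<^esub> g = f * g"
    "\<zero>\<^bsub>plucker_poly_ring k n\<^esub> = 0" "\<one>\<^bsub>plucker_poly_ring k n\<^esub> = 1"
  by (simp_all add: plucker_poly_ring_def)

lemma cring_plucker_poly_ring: "cring (plucker_poly_ring k n)"
proof (rule cringI)
  let ?R = "plucker_poly_ring k n"
  have add: "f + g \<in> carrier ?R" if "f \<in> carrier ?R" "g \<in> carrier ?R" for f g
    using that keys_add[of f g] unfolding carrier_plucker_poly_ring by blast
  have mult: "f * g \<in> carrier ?R" if fg: "f \<in> carrier ?R" "g \<in> carrier ?R" for f g
    unfolding carrier_plucker_poly_ring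
  proof
    fix m assume "m \<in> Poly_Mapping.keys (f * g)"
    then obtain a b where "m = a + b" "a \<in> Poly_Mapping.keys f" "b \<in> Poly_Mapping.keys g"
      using keys_mult[of f g] by auto
    then show "Poly_Mapping.keys m \<subseteq> index_sets k n"
      using keys_add[of a b] fg unfolding carrier_plucker_poly_ring by blast
  qed
  have const: "0 \<in> carrier ?R" "1 \<in> carrier ?R"
    by (simp_all add: carrier_plucker_poly_ring)
  show "abelian_group ?R"
  proof (rule abelian_groupI)
    fix f assume "f \<in> carrier ?R"
    then have "- f \<in> carrier ?R" by (simp add: carrier_plucker_poly_ring keys_uminus)
    then show "\<exists>g\<in>carrier ?R. g \<oplus>\<^bsub>?R\<^esub> f = \<zero>\<^bsub>?R\<^esub>"
      by (intro bexI[of _ "- f"]) (simp_all add: plucker_poly_ring_ops)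
  qed (simp_all add: plucker_poly_ring_ops add const add.assoc)
  show "comm_monoid ?R"
    by (rule comm_monoidI) (simp_all add: plucker_poly_ring_ops mult const mult_ac)
qed (simp add: plucker_poly_ring_ops distrib_right)

lemma plucker_poly_ring_uminus:
  assumes "f \<in> carrier (plucker_poly_ring k n)"
  shows "\<ominus>\<^bsub>plucker_poly_ring k n\<^esub> f = - f"
proof -
  interpret cring "plucker_poly_ring k n" by (rule cring_plucker_poly_ring)
  have "- f \<in> carrier (plucker_poly_ring k n)"
    using assms by (simp add: carrier_plucker_poly_ring keys_uminus)
  then show ?thesis using assms
    by (intro minus_equality) (simp_all add: plucker_poly_ring_ops)
qed

lemma ideal_vanishing_ideal: "ideal (vanishing_ideal k n D) (plucker_poly_ring k n)"
proof -
  let ?R = "plucker_poly_ring k n" and ?I = "vanishing_ideal k n D"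
  interpret cring ?R by (rule cring_plucker_poly_ring)
  have mem: "f \<in> ?I \<longleftrightarrow> f \<in> carrier ?R \<and>
    (\<forall>A \<in> full_rank_mats k n. row_span A \<in> D \<longrightarrow> eval_poly (plucker A) f = 0)" for f
    by (simp add: vanishing_ideal_def)
  show ?thesis
  proof (rule idealI)
    show "ring ?R" by (rule ring_axioms)
    show "subgroup ?I (add_monoid ?R)"
    proof (rule add.subgroupI)
      show "?I \<subseteq> carrier ?R" by (auto simp: mem)
      show "?I \<noteq> {}" using mem[of 0] zero_closed by (auto simp: plucker_poly_ring_ops)
      show "\<ominus>\<^bsub>?R\<^esub> f \<in> ?I" if "f \<in> ?I" for f
        using that a_inv_closed[of f] by (auto simp: mem plucker_poly_ring_uminus eval_poly_uminus)
      show "f \<oplus>\<^bsub>?R\<^esub> g \<in> ?I" if "f \<in> ?I" "g \<in> ?I" for f g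
        using that a_closed[of f g] by (auto simp: mem plucker_poly_ring_ops eval_poly_add)
    qed
    show "g \<otimes>\<^bsub>?R\<^esub> f \<in> ?I" "f \<otimes>\<^bsub>?R\<^esub> g \<in> ?I" if "f \<in> ?I" "g \<in> carrier ?R" for f g
      using that m_closed[of f g] m_closed[of g f] by (auto simp: mem plucker_poly_ring_ops eval_poly_mult)
  qed
qed

text \<open>Irreducibility in elementary form: if two polynomials, each nonzero somewhere on
  \<open>D\<close>, are always nonzero together at some common point, then their product does not
  vanish on \<open>D\<close>. The point \<open>A\<close> makes the ideal proper.\<close>

lemma primeideal_vanishing_ideal:
  assumes "A \<in> full_rank_mats k n" "row_span A \<in> D"
    and joint: "\<And>A B f g. A \<in> full_rank_mats k n \<Longrightarrow> row_span A \<in> D \<Longrightarrow> B \<in> full_rank_mats k n \<Longrightarrow> row_span B \<in> D \<Longrightarrow>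
      f \<in> carrier (plucker_poly_ring k n) \<Longrightarrow> g \<in> carrier (plucker_poly_ring k n) \<Longrightarrow>
      eval_poly (plucker A) f \<noteq> 0 \<Longrightarrow> eval_poly (plucker B) g \<noteq> 0 \<Longrightarrow>
      \<exists>C\<in>full_rank_mats k n. row_span C \<in> D \<and> eval_poly (plucker C) f \<noteq> 0 \<and> eval_poly (plucker C) g \<noteq> 0"
  shows "primeideal (vanishing_ideal k n D) (plucker_poly_ring k n)"
proof (rule primeidealI[OF ideal_vanishing_ideal cring_plucker_poly_ring])
  let ?R = "plucker_poly_ring k n" and ?I = "vanishing_ideal k n D"
  interpret cring ?R by (rule cring_plucker_poly_ring)
  have "\<one>\<^bsub>?R\<^esub> \<notin> ?I" using assms(1,2) by (auto simp: vanishing_ideal_def plucker_poly_ring_ops)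
  then show "carrier ?R \<noteq> ?I" using one_closed by blast
  fix f g assume fg: "f \<in> carrier ?R" "g \<in> carrier ?R" "f \<otimes>\<^bsub>?R\<^esub> g \<in> ?I"
  show "f \<in> ?I \<or> g \<in> ?I"
  proof (rule ccontr)
    assume "\<not> (f \<in> ?I \<or> g \<in> ?I)"
    then obtain A B where "A \<in> full_rank_mats k n" "row_span A \<in> D" "eval_poly (plucker A) f \<noteq> 0"
        "B \<in> full_rank_mats k n" "row_span B \<in> D" "eval_poly (plucker B) g \<noteq> 0"
      using fg(1,2) unfolding vanishing_ideal_def by blast
    then obtain C where "C \<in> full_rank_mats k n" "row_span C \<in> D"
        "eval_poly (plucker C) f \<noteq> 0" "eval_poly (plucker C) g \<noteq> 0"
      using joint[of A B f g] fg(1,2) by blast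
    with fg(3) show False
      by (auto simp: vanishing_ideal_def plucker_poly_ring_ops eval_poly_mult)
  qed
qed

text \<open>Allows one matrix to be replaced by another whose Plucker coordinates are known to agree
  only on \<open>index_sets k n\<close>.\<close>

lemma eval_poly_cong:
  assumes "f \<in> carrier (plucker_poly_ring k n)" "\<And>I. I \<in> index_sets k n \<Longrightarrow> x I = y I"
  shows "eval_poly x f = eval_poly y f"
  unfolding eval_poly_def
proof (intro sum.cong refl arg_cong2[of _ _ _ _ "(*)"] prod.cong)
  fix m I assume "m \<in> Poly_Mapping.keys f" "I \<in> Poly_Mapping.keys m"
  then have "I \<in> index_sets k n" using assms(1) unfolding carrier_plucker_poly_ring by blast
  then show "x I ^ Poly_Mapping.lookup m I = y I ^ Poly_Mapping.lookup m I" by (simp add: assms(2))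
qed

lemma eval_plucker_var:
  "eval_poly x (plucker_var n T) =
    (let r = (\<lambda>i. (i - 1) mod n + 1) in if inj_on r T then x (r ` T) else 0)"
  by (simp add: plucker_var_def Let_def eval_poly_single eval_monom_def)

lemma plucker_var_carrier:
  assumes "n > 0" "card T = k"
  shows "plucker_var n T \<in> carrier (plucker_poly_ring k n)"
proof -
  let ?r = "\<lambda>i. (i - 1) mod n + 1"
  have "?r ` T \<in> index_sets k n" if "inj_on ?r T"
    using assms that by (auto simp: index_sets_def card_image Suc_le_eq)
  then show ?thesis by (auto simp: plucker_var_def carrier_plucker_poly_ring Let_def)
qed

text \<open>From pointwise identities to the fraction field: \<open>S - c T\<close> lies in the
  vanishing ideal, so the class of \<open>S\<close> is \<open>c\<close> times that of
  \<open>T\<close>, and the latter is nonzero because \<open>T\<close> takes a nonzero value.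
  Primality makes the quotient a domain.\<close>

lemma coord_ring_ratio:
  assumes prime: "primeideal (vanishing_ideal k n D) (plucker_poly_ring k n)"
    and S: "S \<in> carrier (plucker_poly_ring k n)" and T: "T \<in> carrier (plucker_poly_ring k n)"
    and ratio: "\<And>A. A \<in> full_rank_mats k n \<Longrightarrow> row_span A \<in> D \<Longrightarrow>
      eval_poly (plucker A) S = c * eval_poly (plucker A) T"
    and nz: "A \<in> full_rank_mats k n" "row_span A \<in> D" "eval_poly (plucker A) T \<noteq> 0"
  shows "coord_class k n D T \<noteq> \<zero>\<^bsub>coord_ring k n D\<^esub> \<and>
    to_frac (coord_ring k n D) (coord_class k n D S)
      \<otimes>\<^bsub>fraction_field (coord_ring k n D)\<^esub>
    inv\<^bsub>fraction_field (coord_ring k n D)\<^esub> to_frac (coord_ring k n D) (coord_class k n D T) =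
    to_frac (coord_ring k n D) (coord_class k n D (const_poly c))"
proof -
  let ?R = "plucker_poly_ring k n" and ?I = "vanishing_ideal k n D" and ?Q = "coord_ring k n D"
  interpret R: cring ?R by (rule cring_plucker_poly_ring)
  interpret I: primeideal ?I ?R by (rule prime)
  interpret Q: domain ?Q unfolding coord_ring_def by (rule I.quotient_is_domain)
  interpret h: ring_hom_ring ?R ?Q "coord_class k n D"
  proof -
    have "coord_class k n D = (+>\<^bsub>?R\<^esub>) ?I" by (rule ext) (simp only: coord_class_def)
    then show "ring_hom_ring ?R ?Q (coord_class k n D)"
      unfolding coord_ring_def using I.rcos_ring_hom_ring by simp
  qed
  have const: "const_poly c \<in> carrier ?R"
    by (simp add: const_poly_def carrier_plucker_poly_ring)
  have zero: "\<zero>\<^bsub>?Q\<^esub> = ?I" unfolding coord_ring_def FactRing_def by (rule ring_record_simps)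
  have "T \<notin> ?I" using nz unfolding vanishing_ideal_def by blast
  then have T0: "coord_class k n D T \<noteq> \<zero>\<^bsub>?Q\<^esub>"
    using I.rcos_const_imp_mem[OF T] unfolding zero coord_class_def by metis
  have cT: "const_poly c \<otimes>\<^bsub>?R\<^esub> T \<in> carrier ?R" using const T by (rule R.m_closed)
  have "S \<ominus>\<^bsub>?R\<^esub> const_poly c \<otimes>\<^bsub>?R\<^esub> T \<in> ?I"
    unfolding vanishing_ideal_def
  proof (intro CollectI conjI ballI impI)
    show "S \<ominus>\<^bsub>?R\<^esub> const_poly c \<otimes>\<^bsub>?R\<^esub> T \<in> carrier ?R" using S cT by (rule R.minus_closed)
    fix A assume "A \<in> full_rank_mats k n" "row_span A \<in> D"
    then show "eval_poly (plucker A) (S \<ominus>\<^bsub>?R\<^esub> const_poly c \<otimes>\<^bsub>?R\<^esub> T) = 0"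
      unfolding a_minus_def plucker_poly_ring_uminus[OF cT]
      by (simp only: plucker_poly_ring_ops eval_poly_add eval_poly_uminus eval_poly_mult eval_const_poly ratio) simp
  qed
  then have "coord_class k n D S = coord_class k n D (const_poly c \<otimes>\<^bsub>?R\<^esub> T)"
    unfolding coord_class_def
    by (rule iffD1[OF R.quotient_eq_iff_same_a_r_cos[OF I.ideal_axioms S cT]])
  then have eq: "coord_class k n D S = coord_class k n D (const_poly c) \<otimes>\<^bsub>?Q\<^esub> coord_class k n D T"
    unfolding h.hom_mult[OF const T] .
  have "to_frac ?Q (coord_class k n D S) \<otimes>\<^bsub>fraction_field ?Q\<^esub>
      inv\<^bsub>fraction_field ?Q\<^esub> to_frac ?Q (coord_class k n D T) =
      ring_frac ?Q (coord_class k n D S) (coord_class k n D T)"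
    using T0 h.hom_closed[OF S] h.hom_closed[OF T] by (intro Q.to_frac_divide) simp_all
  also have "\<dots> = to_frac ?Q (coord_class k n D (const_poly c))"
    unfolding to_frac_def
  proof (rule iffD2[OF Q.frac_eq_iff])
    show "coord_class k n D S \<otimes>\<^bsub>?Q\<^esub> \<one>\<^bsub>?Q\<^esub> =
        coord_class k n D (const_poly c) \<otimes>\<^bsub>?Q\<^esub> coord_class k n D T"
      unfolding eq[symmetric] using h.hom_closed[OF S] by (rule Q.r_one)
  qed (use T0 h.hom_closed[OF S] h.hom_closed[OF T] h.hom_closed[OF const] in simp_all)
  finally show ?thesis using T0 by blast
qed

section \<open>The symmetric q-binomial theorem\<close>

lemma fls_X_intpow_diff_neq_0:
  assumes "m > 0" shows "fls_X_intpow (int m) - fls_X_intpow (- int m) \<noteq> (0 :: complex fls)"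
proof
  assume "fls_X_intpow (int m) - fls_X_intpow (- int m) = (0 :: complex fls)"
  then have "fls_nth (fls_X_intpow (int m) - fls_X_intpow (- int m)) (int m) = (0 :: complex)" by simp
  then show False using assms by simp
qed

lemma fls_X_minus_inv_neq_0: "fls_X - fls_X_inv \<noteq> (0 :: complex fls)"
  using fls_X_intpow_diff_neq_0[of 1] by (simp add: fls_X_conv_shift_1 fls_X_inv_conv_shift_1)

lemma q_int_neq_0: "m > 0 \<Longrightarrow> q_int m \<noteq> 0"
  using fls_X_intpow_diff_neq_0 fls_X_minus_inv_neq_0 by (simp add: q_int_def)

lemma q_fact_Suc: "q_fact (Suc m) = q_int (Suc m) * q_fact m"
  by (simp add: q_fact_def mult.commute)

lemma q_fact_neq_0: "q_fact m \<noteq> 0"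
  by (induction m) (auto simp: q_fact_Suc q_int_neq_0, simp add: q_fact_def)

lemma q_binomial_0_right [simp]: "q_binomial k 0 = 1"
  and q_binomial_self [simp]: "q_binomial k k = 1"
  using q_fact_neq_0[of k] by (simp_all add: q_binomial_def q_fact_def)

text \<open>After multiplication by the common denominator, the powers of exponent
  \<open>2 * s - k - 1\<close> cancel and the two extreme powers remain.\<close>

lemma q_int_split:
  assumes "s \<le> Suc k"
  shows "q_int (Suc k) = fls_X_intpow (int s) * q_int (Suc k - s) + fls_X_intpow (int s - 1 - int k) * q_int s"
proof -
  define E :: "int \<Rightarrow> complex fls" where "E i = fls_X_intpow i" for i
  have E: "E i * E j = E (i + j)" for i j
    by (simp only: E_def fls_X_intpow_times_fls_X_intpow)
  have "E (int s) * (E (int (Suc k - s)) - E (- int (Suc k - s)))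
      + E (int s - 1 - int k) * (E (int s) - E (- int s)) = E (int (Suc k)) - E (- int (Suc k))"
    using assms by (simp add: right_diff_distrib E of_nat_diff)
  then show ?thesis
    unfolding q_int_def E_def[symmetric] by (simp only: times_divide_eq_right add_divide_distrib[symmetric])
qed

text \<open>The symmetric Pascal rule: \<open>q_int_split\<close> applied to the leading factor of
  \<open>q_fact (Suc k)\<close>.\<close>

lemma q_binomial_Suc:
  assumes "1 \<le> s" "s \<le> k"
  shows "q_binomial (Suc k) s =
    fls_X_intpow (int s) * q_binomial k s + fls_X_intpow (int s - 1 - int k) * q_binomial k (s - 1)"
proof -
  \<comment> \<open>With \<open>s = Suc r\<close> and \<open>k = s + m\<close>, all factorials
    unfold to multiples of \<open>q_fact r\<close>, \<open>q_fact m\<close> and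
    \<open>q_fact k\<close>.\<close>
  obtain r where s: "s = Suc r" using assms by (cases s) auto
  obtain m where k: "k = s + m" using assms(2) le_Suc_ex by blast
  have nz: "q_fact r \<noteq> 0" "q_fact m \<noteq> 0" "q_int (Suc r) \<noteq> 0" "q_int (Suc m) \<noteq> 0"
    by (simp_all add: q_fact_neq_0 q_int_neq_0)
  have *: "q_int (Suc k) = fls_X_intpow (int s) * q_int (Suc m) + fls_X_intpow (int s - 1 - int k) * q_int (Suc r)"
    using q_int_split[of s k] k s by simp
  have d: "Suc k - s = Suc m" "k - s = m" "s - 1 = r" "k - r = Suc m" using k s by auto
  show ?thesis
    unfolding q_binomial_def d unfolding s q_fact_Suc * using nz unfolding s by (simp add: field_simps)
qed

text \<open>The definition is a quotient of Laurent series; the Pascal rule shows inductively that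
  it converges everywhere away from 0, so that \<open>eval_fls\<close> respects the sums and
  products below.\<close>

lemma fls_conv_radius_q_binomial: "s \<le> k \<Longrightarrow> fls_conv_radius (q_binomial k s) = \<infinity>"
proof (induction k arbitrary: s)
  case (Suc k)
  show ?case
  proof (cases "s = 0 \<or> s = Suc k")
    case False
    then have s: "1 \<le> s" "s \<le> k" using Suc.prems by auto
    let ?F = "fls_X_intpow (int s) * q_binomial k s"
      and ?G = "fls_X_intpow (int s - 1 - int k) * q_binomial k (s - 1)"
    have "fls_conv_radius ?F \<ge> min (fls_conv_radius (fls_X_intpow (int s) :: complex fls)) (fls_conv_radius (q_binomial k s))"
      by (rule fls_conv_radius_mult)
    moreover have "fls_conv_radius ?G \<ge> min (fls_conv_radius (fls_X_intpow (int s - 1 - int k) :: complex fls)) (fls_conv_radius (q_binomial k (s - 1)))"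
      by (rule fls_conv_radius_mult)
    moreover have "fls_conv_radius (?F + ?G) \<ge> min (fls_conv_radius ?F) (fls_conv_radius ?G)"
      by (rule fls_conv_radius_add)
    ultimately show ?thesis using s Suc.IH[of s] Suc.IH[of "s - 1"] by (simp add: q_binomial_Suc)
  qed auto
qed simp

lemma eval_q_binomial_Suc:
  assumes "1 \<le> s" "s \<le> k" "x \<noteq> 0"
  shows "eval_fls (q_binomial (Suc k) s) x =
    x ^ s * eval_fls (q_binomial k s) x + x powi (int s - 1 - int k) * eval_fls (q_binomial k (s - 1)) x"
proof -
  have r: "fls_conv_radius (fls_X_intpow m * q_binomial k t) = \<infinity>" if "t \<le> k" for m t
    using fls_conv_radius_mult[of "fls_X_intpow m" "q_binomial k t"] that
    by (simp add: fls_conv_radius_q_binomial)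
  have "eval_fls (fls_X_intpow m * q_binomial k t) x = x powi m * eval_fls (q_binomial k t) x" if "t \<le> k" for m t
    using that assms(3) by (subst eval_fls_mult) (simp_all add: fls_conv_radius_q_binomial)
  then have "eval_fls (fls_X_intpow a * q_binomial k t + fls_X_intpow b * q_binomial k u) x =
      x powi a * eval_fls (q_binomial k t) x + x powi b * eval_fls (q_binomial k u) x"
    if "t \<le> k" "u \<le> k" for a b t u
    using that assms(3) by (subst eval_fls_add) (simp_all add: r)
  from this[of s "s - 1" "int s"] show ?thesis
    unfolding q_binomial_Suc[OF assms(1,2)] using assms(2) by (simp only: power_int_of_nat)
qed

text \<open>Induction on \<open>k\<close> with \<open>t\<close> arbitrary, since the inductive step
  applies the hypothesis at \<open>x * t\<close>. Here \<open>x\<close> plays the role of the square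
  root of \<open>q\<close>.\<close>

lemma q_binomial_theorem:
  assumes "x \<noteq> 0"
  shows "(\<Prod>j<k. 1 + x powi (int k - 1 - 2 * int j) * t) = (\<Sum>s\<le>k. eval_fls (q_binomial k s) x * t ^ s)"
proof (induction k arbitrary: t)
  case 0
  show ?case by simp
next
  case (Suc k)
  let ?B = "\<lambda>k s. eval_fls (q_binomial k s) x"
  \<comment> \<open>Passing from \<open>k\<close> to \<open>Suc k\<close> raises the exponents for
    \<open>j < k\<close> by one, which \<open>x * t\<close> absorbs; the new factor
    \<open>j = k\<close> has exponent \<open>- k\<close>.\<close>
  have "(\<Prod>j<Suc k. 1 + x powi (int (Suc k) - 1 - 2 * int j) * t) =
      (\<Prod>j<k. 1 + x powi (int k - 1 - 2 * int j) * (x * t)) * (1 + x powi (- int k) * t)"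
  proof -
    have shift: "x powi (int (Suc k) - 1 - 2 * int j) = x powi (int k - 1 - 2 * int j) * x" for j
      using assms power_int_add_1[of x "int k - 1 - 2 * int j"] by simp
    have "(\<Prod>j<k. 1 + x powi (int (Suc k) - 1 - 2 * int j) * t) =
        (\<Prod>j<k. 1 + x powi (int k - 1 - 2 * int j) * (x * t))"
      unfolding shift by (simp only: mult.assoc)
    moreover have "int (Suc k) - 1 - 2 * int k = - int k" by simp
    ultimately show ?thesis by (simp only: prod.lessThan_Suc)
  qed
  also have "\<dots> = (\<Sum>s\<le>k. ?B k s * (x * t) ^ s) * (1 + x powi (- int k) * t)"
    by (simp only: Suc.IH)
  also have "\<dots> = (\<Sum>s\<le>k. x ^ s * ?B k s * t ^ s) + (\<Sum>s\<le>k. x powi (int s - int k) * ?B k s * t ^ Suc s)"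
  proof -
    have "x powi (int s - int k) = x ^ s * x powi (- int k)" for s
      using assms power_int_add[of x "int s" "- int k"] by simp
    then have "?B k s * (x * t) ^ s * (1 + x powi (- int k) * t) =
        x ^ s * ?B k s * t ^ s + x powi (int s - int k) * ?B k s * t ^ Suc s" for s
      by (simp only: power_mult_distrib power_Suc distrib_left mult_1_left mult_1_right mult_ac)
    then show ?thesis by (simp only: sum_distrib_right sum.distrib)
  qed
  \<comment> \<open>The end coefficients, of \<open>t ^ 0\<close> and \<open>t ^ Suc k\<close>, are
    split off because the Pascal rule covers only the indices between them.\<close>
  also have "(\<Sum>s\<le>k. x ^ s * ?B k s * t ^ s) = 1 + (\<Sum>s<k. x ^ Suc s * ?B k (Suc s) * t ^ Suc s)"
    by (subst sum.atMost_shift) simp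
  also have "(\<Sum>s\<le>k. x powi (int s - int k) * ?B k s * t ^ Suc s) =
      (\<Sum>s<k. x powi (int s - int k) * ?B k s * t ^ Suc s) + t ^ Suc k"
    by (simp add: lessThan_Suc_atMost[symmetric])
  also have "1 + (\<Sum>s<k. x ^ Suc s * ?B k (Suc s) * t ^ Suc s) +
      ((\<Sum>s<k. x powi (int s - int k) * ?B k s * t ^ Suc s) + t ^ Suc k) =
      1 + (\<Sum>s<k. ?B (Suc k) (Suc s) * t ^ Suc s) + t ^ Suc k"
  proof -
    have "x ^ Suc s * ?B k (Suc s) * t ^ Suc s + x powi (int s - int k) * ?B k s * t ^ Suc s =
        ?B (Suc k) (Suc s) * t ^ Suc s" if "s < k" for s
      using eval_q_binomial_Suc[of "Suc s" k x] that assms by (simp add: distrib_right)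
    then have sum_eq: "(\<Sum>s<k. x ^ Suc s * ?B k (Suc s) * t ^ Suc s) +
        (\<Sum>s<k. x powi (int s - int k) * ?B k s * t ^ Suc s) = (\<Sum>s<k. ?B (Suc k) (Suc s) * t ^ Suc s)"
      by (subst sum.distrib[symmetric], intro sum.cong) auto
    show ?thesis unfolding sum_eq[symmetric] by (simp only: add.assoc)
  qed
  also have "\<dots> = (\<Sum>s\<le>Suc k. ?B (Suc k) s * t ^ s)"
    by (subst sum.atMost_Suc, subst sum.atMost_shift) simp
  finally show ?case .
qed

section \<open>Rank and minors\<close>

lemma transpose_mult_vec_index:
  fixes A :: "complex mat"
  assumes "A \<in> carrier_mat k n" "y \<in> carrier_vec k" "j < n"
  shows "vec_index (mult_mat_vec (transpose_mat A) y) j = (\<Sum>a<k. vec_index y a * A $$ (a, j))"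
  using assms by (auto simp: scalar_prod_def atLeast0LessThan intro!: sum.cong mult.commute)

lemma row_span_iff:
  assumes A: "A \<in> carrier_mat k n"
  shows "v \<in> row_span A \<longleftrightarrow> (\<exists>y. v = Matrix.vec n (\<lambda>j. \<Sum>a<k. y a * A $$ (a, j)))"
proof
  assume "v \<in> row_span A"
  then obtain y where "y \<in> carrier_vec k" "v \<in> carrier_vec n" "mult_mat_vec (transpose_mat A) y = v"
    using A vec_space.row_space_eq[of A k "dim_col A"] by auto
  then have "v = Matrix.vec n (\<lambda>j. \<Sum>a<k. vec_index y a * A $$ (a, j))"
    using transpose_mult_vec_index[OF A] by (intro eq_vecI) auto
  then show "\<exists>y. v = Matrix.vec n (\<lambda>j. \<Sum>a<k. y a * A $$ (a, j))" by (intro exI)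
next
  assume "\<exists>y. v = Matrix.vec n (\<lambda>j. \<Sum>a<k. y a * A $$ (a, j))"
  then obtain y where y: "v = Matrix.vec n (\<lambda>j. \<Sum>a<k. y a * A $$ (a, j))" ..
  have "mult_mat_vec (transpose_mat A) (Matrix.vec k y) = v"
    unfolding y using transpose_mult_vec_index[OF A, of "Matrix.vec k y"] A
    by (intro eq_vecI) (auto intro!: sum.cong)
  then show "v \<in> row_span A"
    using A y vec_space.row_space_eq[of A k "dim_col A"] by (auto intro!: bexI[of _ "Matrix.vec k y"])
qed

text \<open>Stated through coefficients of the indexed family of rows: in the set of rows a
  repetition would be invisible.\<close>

definition rows_indep :: "complex mat \<Rightarrow> bool" where
  "rows_indep A \<longleftrightarrow> (\<forall>y. (\<forall>j<dim_col A. (\<Sum>a<dim_row A. y a * A $$ (a, j)) = 0) \<longrightarrow> (\<forall>a<dim_row A. y a = 0))"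

definition conj_transpose :: "complex mat \<Rightarrow> complex mat" where
  "conj_transpose A = mat (dim_col A) (dim_row A) (\<lambda>(j, b). cnj (A $$ (b, j)))"

text \<open>The Gram matrix of the rows for the Hermitian inner product. Its determinant is a single
  continuous function of the entries that detects full row rank.\<close>

definition gram :: "complex mat \<Rightarrow> complex mat" where
  "gram A = A * conj_transpose A"

lemma gram_carrier: "A \<in> carrier_mat k n \<Longrightarrow> gram A \<in> carrier_mat k k"
  by (auto simp: gram_def conj_transpose_def)

lemma gram_index:
  assumes "A \<in> carrier_mat k n" "a < k" "b < k"
  shows "gram A $$ (a, b) = (\<Sum>j<n. A $$ (a, j) * cnj (A $$ (b, j)))"
  using assms by (auto simp: gram_def conj_transpose_def scalar_prod_def atLeast0LessThan intro!: sum.cong)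

lemma det_eq_0_left_kernel:
  fixes G :: "complex mat"
  assumes G: "G \<in> carrier_mat k k"
  shows "Determinant.det G = 0 \<longleftrightarrow> (\<exists>y. (\<exists>a<k. y a \<noteq> 0) \<and> (\<forall>b<k. (\<Sum>a<k. y a * G $$ (a, b)) = 0))"
proof -
  have "Determinant.det G = 0 \<longleftrightarrow> Determinant.det (transpose_mat G) = 0" using det_transpose[OF G] by simp
  also have "\<dots> \<longleftrightarrow> (\<exists>v. v \<in> carrier_vec k \<and> v \<noteq> 0\<^sub>v k \<and> mult_mat_vec (transpose_mat G) v = 0\<^sub>v k)"
    using G by (intro det_0_iff_vec_prod_zero) auto
  also have "\<dots> \<longleftrightarrow> (\<exists>y. (\<exists>a<k. y a \<noteq> 0) \<and> (\<forall>b<k. (\<Sum>a<k. y a * G $$ (a, b)) = 0))"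
  proof safe
    fix v assume v: "v \<in> carrier_vec k" "v \<noteq> 0\<^sub>v k" and 0: "mult_mat_vec (transpose_mat G) v = 0\<^sub>v k"
    have "\<exists>a<k. vec_index v a \<noteq> 0" using v by (metis carrier_vecD eq_vecI index_zero_vec)
    moreover have "(\<Sum>a<k. vec_index v a * G $$ (a, b)) = 0" if "b < k" for b
      using transpose_mult_vec_index[OF G v(1) that] 0 that by simp
    ultimately show "\<exists>y. (\<exists>a<k. y a \<noteq> 0) \<and> (\<forall>b<k. (\<Sum>a<k. y a * G $$ (a, b)) = 0)"
      by (intro exI[of _ "vec_index v"]) auto
  next
    fix y a assume y: "\<forall>b<k. (\<Sum>a<k. y a * G $$ (a, b)) = 0" "a < k" "y a \<noteq> 0"
    have "mult_mat_vec (transpose_mat G) (Matrix.vec k y) = 0\<^sub>v k"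
      using transpose_mult_vec_index[OF G, of "Matrix.vec k y"] G y
      by (intro eq_vecI) auto
    moreover have "Matrix.vec k y \<noteq> 0\<^sub>v k" using y by (metis index_vec index_zero_vec(1))
    ultimately show "\<exists>v. v \<in> carrier_vec k \<and> v \<noteq> 0\<^sub>v k \<and> mult_mat_vec (transpose_mat G) v = 0\<^sub>v k"
      by (intro exI[of _ "Matrix.vec k y"]) auto
  qed
  finally show ?thesis .
qed

text \<open>If \<open>y\<close> annihilates the Gram matrix from the left, then pairing with the
  conjugate of \<open>y\<close> gives the squared norm of the combination of rows with coefficients
  \<open>y\<close>, so this combination is zero. Conversely, a relation among the rows of
  \<open>A\<close> is one among the rows of \<open>gram A\<close>.\<close>

lemma rows_indep_iff_gram:
  assumes A: "A \<in> carrier_mat k n"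
  shows "rows_indep A \<longleftrightarrow> Determinant.det (gram A) \<noteq> 0"
proof
  assume ind: "rows_indep A"
  show "Determinant.det (gram A) \<noteq> 0"
  proof
    assume "Determinant.det (gram A) = 0"
    then obtain y where nz: "\<exists>a<k. y a \<noteq> 0" and y: "\<And>b. b < k \<Longrightarrow> (\<Sum>a<k. y a * gram A $$ (a, b)) = 0"
      unfolding det_eq_0_left_kernel[OF gram_carrier[OF A]] by auto
    let ?v = "\<lambda>j. \<Sum>a<k. y a * A $$ (a, j)"
    have "(\<Sum>j<n. ?v j * cnj (?v j)) = (\<Sum>j<n. \<Sum>b<k. ?v j * cnj (y b) * cnj (A $$ (b, j)))"
      by (simp add: sum_distrib_left mult.assoc)
    also have "\<dots> = (\<Sum>b<k. \<Sum>j<n. \<Sum>a<k. cnj (y b) * (y a * (A $$ (a, j) * cnj (A $$ (b, j)))))"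
      by (subst sum.swap) (simp add: sum_distrib_left sum_distrib_right mult_ac)
    also have "\<dots> = (\<Sum>b<k. cnj (y b) * (\<Sum>a<k. y a * gram A $$ (a, b)))"
    proof (intro sum.cong refl)
      fix b assume "b \<in> {..<k}"
      then have "cnj (y b) * (\<Sum>a<k. y a * gram A $$ (a, b)) =
          (\<Sum>a<k. \<Sum>j<n. cnj (y b) * (y a * (A $$ (a, j) * cnj (A $$ (b, j)))))"
        by (simp add: gram_index[OF A] sum_distrib_left)
      then show "(\<Sum>j<n. \<Sum>a<k. cnj (y b) * (y a * (A $$ (a, j) * cnj (A $$ (b, j))))) =
          cnj (y b) * (\<Sum>a<k. y a * gram A $$ (a, b))"
        by (simp add: sum.swap[of _ "{..<n}"])
    qed
    also have "\<dots> = 0" using y by simp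
    finally have "of_real (\<Sum>j<n. (cmod (?v j))\<^sup>2) = (0 :: complex)"
      by (simp add: complex_norm_square del: of_real_power)
    then have "(\<Sum>j<n. (cmod (?v j))\<^sup>2) = 0" by (simp only: of_real_eq_0_iff)
    then have "\<forall>j<n. ?v j = 0" by (subst (asm) sum_nonneg_eq_0_iff) auto
    then show False using ind nz A by (auto simp: rows_indep_def)
  qed
next
  assume det: "Determinant.det (gram A) \<noteq> 0"
  show "rows_indep A"
    unfolding rows_indep_def
  proof (intro allI impI)
    fix y a assume y: "\<forall>j<dim_col A. (\<Sum>a<dim_row A. y a * A $$ (a, j)) = 0" and a: "a < dim_row A"
    have "(\<Sum>a<k. y a * gram A $$ (a, b)) = 0" if "b < k" for b
    proof -
      have "(\<Sum>a<k. y a * gram A $$ (a, b)) = (\<Sum>a<k. \<Sum>j<n. y a * (A $$ (a, j) * cnj (A $$ (b, j))))"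
        using that by (simp add: gram_index[OF A] sum_distrib_left)
      also have "\<dots> = (\<Sum>j<n. (\<Sum>a<k. y a * A $$ (a, j)) * cnj (A $$ (b, j)))"
        by (subst sum.swap) (simp add: sum_distrib_right mult.assoc)
      finally show ?thesis using y A by simp
    qed
    then show "y a = 0" using det a A unfolding det_eq_0_left_kernel[OF gram_carrier[OF A]] by auto
  qed
qed

text \<open>A maximal independent set of columns has as many elements as the rank; when this is the
  dimension, it is a basis.\<close>

lemma (in vec_space) rank_eq_dim_iff_col_space:
  assumes A: "A \<in> carrier_mat n nc"
  shows "rank A = n \<longleftrightarrow> col_space A = carrier_vec n"
proof
  have cols: "set (cols A) \<subseteq> carrier_vec n" using A cols_dim by blast
  assume r: "rank A = n"
  obtain S where S: "maximal S (\<lambda>T. T \<subseteq> set (cols A) \<and> lin_indpt T)"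
    using maximal_exists[of "(\<lambda>T. T \<subseteq> set (cols A) \<and> lin_indpt T)" "card (set (cols A))" "{}"]
    by (meson List.finite_set card_mono empty_iff empty_subsetI finite_lin_indpt2 rev_finite_subset)
  then have sub: "S \<subseteq> set (cols A)" "lin_indpt S" by (auto simp: maximal_def)
  have "basis S"
  proof (rule dim_li_is_basis)
    show "finite S" using sub(1) by (rule finite_subset) simp
    show "S \<subseteq> carrier_vec n" using sub(1) cols by blast
    show "dim \<le> card S" unfolding dim_is_n using rank_card_indpt[OF A S] r by (metis order_refl)
  qed (use sub in simp_all)
  then have "span S = carrier_vec n" by (simp add: basis_def)
  moreover have "span S \<subseteq> col_space A"
    unfolding col_space_def using sub by (intro span_is_monotone)
  moreover have "col_space A \<subseteq> carrier_vec n"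
    unfolding col_space_def using span_is_subset2[OF _ ] cols by (simp add: span_closed subsetI)
  ultimately show "col_space A = carrier_vec n" by auto
next
  assume c: "col_space A = carrier_vec n"
  then have "span_vs (set (cols A)) = V" by (simp add: col_space_def module_vec_def)
  then show "rank A = n" by (simp add: rank_def dim_is_n)
qed

text \<open>Full rank means that \<open>A\<close> is onto as a map on column vectors. A preimage of
  a unit vector then reads off a coefficient of any row relation; conversely, an invertible Gram
  matrix provides a right inverse of \<open>A\<close>.\<close>

lemma rank_eq_rows_iff:
  assumes A: "A \<in> carrier_mat k n"
  shows "vec_space.rank k A = k \<longleftrightarrow> rows_indep A"
proof -
  have "vec_space.rank k A = k \<longleftrightarrow> (\<forall>v\<in>carrier_vec k. \<exists>x\<in>carrier_vec n. mult_mat_vec A x = v)"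
    unfolding vec_space.rank_eq_dim_iff_col_space[OF A] vec_space.col_space_eq[OF A]
    using A by auto
  also have "\<dots> \<longleftrightarrow> rows_indep A"
  proof
    assume surj: "\<forall>v\<in>carrier_vec k. \<exists>x\<in>carrier_vec n. mult_mat_vec A x = v"
    show "rows_indep A"
      unfolding rows_indep_def
    proof (intro allI impI)
      fix y a assume y: "\<forall>j<dim_col A. (\<Sum>a<dim_row A. y a * A $$ (a, j)) = 0" and a: "a < dim_row A"
      obtain x where x: "x \<in> carrier_vec n" "mult_mat_vec A x = unit_vec k a"
        using surj by (meson unit_vec_carrier)
      have "y a = (\<Sum>b<k. y b * vec_index (unit_vec k a) b)"
        using a A by (simp add: unit_vec_def if_distrib cong: if_cong)
      also have "\<dots> = (\<Sum>b<k. \<Sum>j<n. y b * (A $$ (b, j) * vec_index x j))"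
        unfolding x(2)[symmetric] using A x(1)
        by (intro sum.cong refl) (simp add: scalar_prod_def atLeast0LessThan sum_distrib_left)
      also have "\<dots> = (\<Sum>j<n. (\<Sum>b<k. y b * A $$ (b, j)) * vec_index x j)"
        by (subst sum.swap) (simp add: sum_distrib_right mult.assoc)
      also have "\<dots> = 0" using y A by simp
      finally show "y a = 0" .
    qed
  next
    assume "rows_indep A"
    then have d: "Determinant.det (gram A) \<noteq> 0" using rows_indep_iff_gram[OF A] by simp
    note G = gram_carrier[OF A]
    have C: "conj_transpose A \<in> carrier_mat n k" using A by (auto simp: conj_transpose_def)
    show "\<forall>v\<in>carrier_vec k. \<exists>x\<in>carrier_vec n. mult_mat_vec A x = v"
    proof
      fix v :: "complex Matrix.vec" assume v: "v \<in> carrier_vec k"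
      \<comment> \<open>Up to the factor \<open>det (gram A)\<close>, this is the inverse Gram
        matrix applied to \<open>v\<close>; its image under \<open>conj_transpose A\<close> is a
        scaled preimage of \<open>v\<close>.\<close>
      let ?w = "mult_mat_vec (adj_mat (gram A)) v"
      have w: "?w \<in> carrier_vec k" using adj_mat(1)[OF G] v by auto
      have "mult_mat_vec A (mult_mat_vec (conj_transpose A) ?w) = mult_mat_vec (gram A) ?w"
        using assoc_mult_mat_vec[OF A C w, folded gram_def] by simp
      also have "\<dots> = mult_mat_vec (gram A * adj_mat (gram A)) v"
        by (rule assoc_mult_mat_vec[OF G adj_mat(1)[OF G] v, symmetric])
      also have "\<dots> = Determinant.det (gram A) \<cdot>\<^sub>v v"
        unfolding adj_mat(2)[OF G] using v by (intro eq_vecI) auto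
      finally have "mult_mat_vec A (inverse (Determinant.det (gram A)) \<cdot>\<^sub>v mult_mat_vec (conj_transpose A) ?w) = v"
        using A C w v d by (simp add: mult_mat_vec smult_smult_assoc)
      then show "\<exists>x\<in>carrier_vec n. mult_mat_vec A x = v" using C w by (metis mult_mat_vec_carrier smult_carrier_vec)
    qed
  qed
  finally show ?thesis .
qed

lemma full_rank_mats_iff: "A \<in> full_rank_mats k n \<longleftrightarrow> A \<in> carrier_mat k n \<and> rows_indep A"
  using rank_eq_rows_iff by (auto simp: full_rank_mats_def)

text \<open>The increasing enumeration of the naturals other than \<open>s\<close>. On
  \<open>{..<k}\<close> it lists \<open>{..k} - {s}\<close>, and \<open>skip k\<close> is the
  identity there.\<close>

definition skip :: "nat \<Rightarrow> nat \<Rightarrow> nat" where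
  "skip s b = (if b < s then b else Suc b)"

lemma strict_mono_skip: "strict_mono (skip s)"
  by (auto simp: strict_mono_def skip_def)

lemma skip_image: "s \<le> k \<Longrightarrow> skip s ` {..<k} = {..k} - {s}"
proof (intro equalityI subsetI)
  fix x assume "s \<le> k" "x \<in> {..k} - {s}"
  then show "x \<in> skip s ` {..<k}"
    by (intro image_eqI[of _ _ "if x < s then x else x - 1"]) (auto simp: skip_def)
qed (auto simp: skip_def)

text \<open>Cramer's rule without division: one linear relation among \<open>k + 1\<close> columns
  makes the maximal minors proportional, up to sign, to its coefficients. The proof computes one
  determinant in two ways.\<close>

lemma minors_of_dependent_columns:
  fixes u :: "nat \<Rightarrow> nat \<Rightarrow> 'a :: comm_ring_1"
  assumes dep: "\<And>a. a < k \<Longrightarrow> (\<Sum>i\<le>k. c i * u a i) = 0" and s: "s \<le> k"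
  shows "(-1) ^ (k + s) * c k * Determinant.det (mat k k (\<lambda>(a, b). u a (skip s b))) =
    c s * Determinant.det (mat k k (\<lambda>(a, b). u a b))"
proof -
  \<comment> \<open>\<open>N\<close> appends the unit row at \<open>s\<close> to the
    \<open>k\<close> given rows, and \<open>E\<close> is the identity with last column
    \<open>c\<close>. By the relation, the last column of \<open>N * E\<close> is zero except for
    \<open>c s\<close> at the bottom.\<close>
  define N where "N = mat (Suc k) (Suc k) (\<lambda>(a, b). if a < k then u a b else if b = s then 1 else 0)"
  define E where "E = mat (Suc k) (Suc k) (\<lambda>(a, b). if b < k then (if a = b then 1 else 0) else c a)"
  have car: "N \<in> carrier_mat (Suc k) (Suc k)" "E \<in> carrier_mat (Suc k) (Suc k)"
    by (auto simp: N_def E_def)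
  have NE: "(N * E) $$ (a, b) = (if b < k then N $$ (a, b) else if a < k then 0 else c s)"
    if "a < Suc k" "b < Suc k" for a b
  proof -
    have "(N * E) $$ (a, b) = (\<Sum>i\<le>k. N $$ (a, i) * E $$ (i, b))"
      using that car by (simp add: scalar_prod_def atLeast0LessThan lessThan_Suc_atMost)
    also have "\<dots> = (if b < k then N $$ (a, b) else if a < k then 0 else c s)"
    proof (cases "b < k")
      case True
      then have "(\<Sum>i\<le>k. N $$ (a, i) * E $$ (i, b)) = (\<Sum>i\<le>k. if i = b then N $$ (a, b) else 0)"
        by (intro sum.cong refl) (simp add: E_def)
      then show ?thesis using True by simp
    next
      case False
      then have E: "E $$ (i, b) = c i" if "i \<le> k" for i using that \<open>b < Suc k\<close> by (simp add: E_def)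
      show ?thesis
      proof (cases "a < k")
        case True
        then have "(\<Sum>i\<le>k. N $$ (a, i) * E $$ (i, b)) = (\<Sum>i\<le>k. c i * u a i)"
          by (intro sum.cong refl) (simp add: E N_def mult.commute)
        then show ?thesis using True False dep by simp
      next
        case a: False
        then have "(\<Sum>i\<le>k. N $$ (a, i) * E $$ (i, b)) = (\<Sum>i\<le>k. if i = s then c s else 0)"
          using \<open>a < Suc k\<close> by (intro sum.cong refl) (simp add: E N_def)
        then show ?thesis using False a s by simp
      qed
    qed
    finally show ?thesis .
  qed
  have detE: "Determinant.det E = c k"
  proof -
    have "diag_mat E = replicate k 1 @ [c k]"
      using car(2) by (intro nth_equalityI) (auto simp: diag_mat_def nth_append E_def less_Suc_eq)
    moreover have "upper_triangular E" by (auto simp: upper_triangular_def E_def)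
    ultimately show ?thesis using det_upper_triangular[OF _ car(2)] by simp
  qed
  \<comment> \<open>Expansion along the appended row leaves the minor that omits column
    \<open>s\<close>.\<close>
  have "Determinant.det N = (\<Sum>j<Suc k. N $$ (k, j) * cofactor N k j)"
    by (rule laplace_expansion_row[OF car(1)]) simp
  also have "\<dots> = (\<Sum>j<Suc k. if j = s then cofactor N k s else 0)"
    by (intro sum.cong refl) (simp add: N_def)
  also have "\<dots> = cofactor N k s"
    using s by simp
  also have "\<dots> = (-1) ^ (k + s) * Determinant.det (mat k k (\<lambda>(a, b). u a (skip s b)))"
    unfolding cofactor_def mat_delete_def
    by (intro arg_cong2[of _ _ _ _ "(*)"] refl arg_cong[of _ _ Determinant.det] eq_matI)
      (auto simp: N_def skip_def)
  finally have detN: "Determinant.det N = (-1) ^ (k + s) * Determinant.det (mat k k (\<lambda>(a, b). u a (skip s b)))" .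
  have "Determinant.det (N * E) = (\<Sum>i<Suc k. (N * E) $$ (i, k) * cofactor (N * E) i k)"
    using car by (intro laplace_expansion_column) auto
  also have "\<dots> = c s * cofactor (N * E) k k"
    using NE[of _ k] by simp
  also have "cofactor (N * E) k k = Determinant.det (mat k k (\<lambda>(a, b). u a b))"
  proof -
    have Nu: "N $$ (a, b) = u a b" if "a < k" "b < k" for a b using that by (simp add: N_def)
    have "mat_delete (N * E) k k = mat k k (\<lambda>(a, b). u a b)"
      using car by (intro eq_matI) (auto simp: mat_delete_def NE Nu simp del: index_mult_mat(1))
    then show ?thesis by (simp add: cofactor_def mult_2[symmetric])
  qed
  finally have "Determinant.det N * Determinant.det E = c s * Determinant.det (mat k k (\<lambda>(a, b). u a b))"
    using det_mult[OF car] by simp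
  then show ?thesis unfolding detN detE by (simp add: mult_ac)
qed

text \<open>Exactly \<open>b\<close> elements of the image lie below \<open>f b\<close>, so
  \<open>f b\<close> is the element that \<open>pick\<close> finds at position
  \<open>b\<close>.\<close>

lemma pick_image_strict_mono:
  assumes f: "strict_mono_on {..<k} f" and b: "b < k"
  shows "pick (f ` {..<k}) b = f b"
proof -
  have "{x \<in> f ` {..<k}. x < f b} = f ` {..<b}"
    using b strict_mono_on_less[OF f] by (auto simp: image_iff)
  moreover have "card (f ` {..<b}) = b"
    using b strict_mono_on_imp_inj_on[OF f] by (subst card_image) (auto intro: inj_on_subset)
  ultimately show ?thesis
    using b pick_card_in_set[of "f b" "f ` {..<k}"] by auto
qed

text \<open>Replaces \<open>submatrix\<close> by an explicit increasing list of columns;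
  \<open>Suc\<close> converts column numbers to Plucker indices.\<close>

lemma plucker_image:
  assumes A: "A \<in> carrier_mat k n" and f: "strict_mono_on {..<k} f" "\<And>b. b < k \<Longrightarrow> f b < n"
  shows "plucker A ((\<lambda>b. Suc (f b)) ` {..<k}) = Determinant.det (mat k k (\<lambda>(a, b). A $$ (a, f b)))"
proof -
  have im: "(\<lambda>i. i - 1) ` (\<lambda>b. Suc (f b)) ` {..<k} = f ` {..<k}" by (simp add: image_image)
  have "{j. j < dim_col A \<and> j \<in> f ` {..<k}} = f ` {..<k}" using A f(2) by auto
  then have c: "card {j. j < dim_col A \<and> j \<in> f ` {..<k}} = k"
    using strict_mono_on_imp_inj_on[OF f(1)] by (simp add: card_image)
  have "submatrix A UNIV (f ` {..<k}) = mat k k (\<lambda>(a, b). A $$ (a, f b))"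
    unfolding submatrix_def c using A
    by (intro eq_matI) (auto simp: pick_UNIV pick_image_strict_mono[OF f(1)])
  then show ?thesis unfolding plucker_def im by simp
qed

lemma index_set_enum:
  assumes "I \<in> index_sets k n"
  obtains f where "strict_mono_on {..<k} f" "\<And>b. b < k \<Longrightarrow> f b < n" "I = (\<lambda>b. Suc (f b)) ` {..<k}"
proof -
  have I: "I \<subseteq> {1..n}" "card I = k" using assms by (auto simp: index_sets_def)
  then have fin: "finite I" by (auto intro: finite_subset)
  define g where "g = (\<lambda>b. pick I b)"
  have g: "g b \<in> I" if "b < k" for b using that I by (simp add: g_def pick_in_set_le)
  have mono: "strict_mono_on {..<k} g"
    unfolding g_def using I by (auto simp: strict_mono_on_def intro: pick_mono_le)
  have "g ` {..<k} = I"
    using g I fin strict_mono_on_imp_inj_on[OF mono] by (intro card_subset_eq) (auto simp: card_image)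
  moreover have pos: "0 < g b" "g b \<le> n" if "b < k" for b using g[OF that] I by auto
  ultimately have "I = (\<lambda>b. Suc (g b - 1)) ` {..<k}" by (auto simp: image_iff)
  moreover have "strict_mono_on {..<k} (\<lambda>b. g b - 1)"
    using mono pos by (auto simp: strict_mono_on_def intro!: diff_less_mono) (metis Suc_leI less_trans)
  moreover have "g b - 1 < n" if "b < k" for b using pos[OF that] by linarith
  ultimately show ?thesis using that[of "\<lambda>b. g b - 1"] by simp
qed

text \<open>Selecting columns commutes with multiplication on the left, so a change of basis scales
  all Plucker coordinates by its determinant.\<close>

lemma plucker_mult_left:
  assumes Q: "Q \<in> carrier_mat k k" and A: "A \<in> carrier_mat k n" and I: "I \<in> index_sets k n"
  shows "plucker (Q * A) I = Determinant.det Q * plucker A I"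
proof -
  obtain f where f: "strict_mono_on {..<k} f" "\<And>b. b < k \<Longrightarrow> f b < n" "I = (\<lambda>b. Suc (f b)) ` {..<k}"
    using index_set_enum[OF I] by metis
  have QA: "Q * A \<in> carrier_mat k n" using Q A by simp
  have "mat k k (\<lambda>(a, b). (Q * A) $$ (a, f b)) = Q * mat k k (\<lambda>(a, b). A $$ (a, f b))"
    using Q A f(2) by (intro eq_matI) (auto simp: scalar_prod_def)
  then show ?thesis
    using plucker_image[OF QA f(1,2)] plucker_image[OF A f(1,2)] Q
    by (simp add: f(3) det_mult[of _ k])
qed

section \<open>Eigenvectors of the shift\<close>

text \<open>The extension of \<open>v\<close> to an infinite sequence that picks up the sign
  \<open>(-1) ^ (k - 1)\<close> at each turn; on such sequences the cyclic shift is just translation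
  by one.\<close>

definition unroll :: "nat \<Rightarrow> complex Matrix.vec \<Rightarrow> nat \<Rightarrow> complex" where
  "unroll k v j = (-1) ^ ((k - 1) * (j div dim_vec v)) * vec_index v (j mod dim_vec v)"

lemma unroll_less: "j < dim_vec v \<Longrightarrow> unroll k v j = vec_index v j"
  by (simp add: unroll_def)

lemma unroll_period:
  assumes "v \<in> carrier_vec n" "n > 0"
  shows "unroll k v (j + n * m) = (-1) ^ ((k - 1) * m) * unroll k v j"
proof -
  have "dim_vec v = n" using assms by simp
  then show ?thesis using assms(2)
    by (simp add: unroll_def power_add distrib_left)
qed

lemma unroll_smult:
  assumes "v \<in> carrier_vec n" "n > 0"
  shows "unroll k (c \<cdot>\<^sub>v v) j = c * unroll k v j"
  using assms by (simp add: unroll_def)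

lemma unroll_combination:
  assumes A: "A \<in> carrier_mat k n" and n: "n > 0"
  shows "unroll k (Matrix.vec n (\<lambda>j. \<Sum>a<k. y a * A $$ (a, j))) j = (\<Sum>a<k. y a * unroll k (row A a) j)"
  using assms by (simp add: unroll_def sum_distrib_left mult_ac)

lemma unroll_eqI:
  assumes "v \<in> carrier_vec n" "w \<in> carrier_vec n" "\<And>j. j < n \<Longrightarrow> unroll k v j = unroll k w j"
  shows "v = w"
  using assms by (intro eq_vecI) (metis carrier_vecD unroll_less, simp)

lemma unroll_eq_0_iff:
  assumes "v \<in> carrier_vec n" "n > 0"
  shows "v = 0\<^sub>v n \<longleftrightarrow> (\<forall>j. unroll k v j = 0)"
proof
  assume "\<forall>j. unroll k v j = 0"
  then show "v = 0\<^sub>v n"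
    using assms by (intro unroll_eqI[of v n _ k]) (auto simp: unroll_def, metis mod_less)
qed (use assms in \<open>simp add: unroll_def\<close>)

lemma shift_vec_carrier: "v \<in> carrier_vec n \<Longrightarrow> (shift_vec k ^^ i) v \<in> carrier_vec n"
  by (induction i) (auto simp: shift_vec_def)

lemma unroll_shift_vec:
  assumes v: "v \<in> carrier_vec n" and n: "n > 0"
  shows "unroll k (shift_vec k v) j = unroll k v (Suc j)"
proof -
  have d: "dim_vec v = n" "dim_vec (shift_vec k v) = n" using v by (auto simp: shift_vec_def)
  have m: "j mod n < n" using n by simp
  show ?thesis
  proof (cases "Suc (j mod n) < n")
    case True
    then have "Suc j mod n = Suc (j mod n)" "Suc j div n = j div n"
      using n by (simp_all add: mod_Suc div_Suc)
    then show ?thesis using True d m by (simp add: unroll_def shift_vec_def)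
  next
    case False
    then have "Suc (j mod n) = n" using m by linarith
    then have "Suc j mod n = 0" "Suc j div n = Suc (j div n)"
      using n by (simp_all add: mod_Suc div_Suc)
    then show ?thesis using False d m by (simp add: unroll_def shift_vec_def power_add mult_ac)
  qed
qed

lemma unroll_shift_vec_pow:
  assumes v: "v \<in> carrier_vec n" and n: "n > 0"
  shows "unroll k ((shift_vec k ^^ i) v) j = unroll k v (i + j)"
proof (induction i arbitrary: j)
  case (Suc i)
  then show ?case
    using unroll_shift_vec[OF shift_vec_carrier[OF v] n] by simp
qed simp

lemma cyclic_shift_pow: "(cyclic_shift k ^^ i) V = (shift_vec k ^^ i) ` V"
  by (induction i) (simp_all add: cyclic_shift_def image_image)

text \<open>Eigenvectors of the \<open>l\<close>-fold shift. The zero vector qualifies as well;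
  being nonzero is demanded separately where it matters.\<close>

definition eigenvec :: "nat \<Rightarrow> nat \<Rightarrow> complex \<Rightarrow> complex Matrix.vec \<Rightarrow> bool" where
  "eigenvec k l c v \<longleftrightarrow> (\<forall>j. unroll k v (j + l) = c * unroll k v j)"

lemma unroll_eigenvec: "eigenvec k l c v \<Longrightarrow> unroll k v (j + i * l) = c ^ i * unroll k v j"
proof (induction i)
  case (Suc i)
  have "unroll k v (j + Suc i * l) = unroll k v ((j + i * l) + l)" by (simp add: add_ac)
  then show ?case using Suc by (simp add: eigenvec_def mult_ac)
qed simp

text \<open>On a subspace stable under the \<open>l\<close>-fold shift, whose \<open>p\<close>-th power is a scalar, this is
  \<open>p\<close> times the projection onto the eigenspace of \<open>c\<close>.\<close>

definition eigenproj :: "nat \<Rightarrow> nat \<Rightarrow> nat \<Rightarrow> complex \<Rightarrow> complex Matrix.vec \<Rightarrow> nat \<Rightarrow> complex" where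
  "eigenproj k l p c v j = (\<Sum>i<p. inverse c ^ i * unroll k v (j + i * l))"

lemma sum_powers_root_of_unity:
  fixes z :: complex
  assumes "z ^ p = 1" shows "(\<Sum>i<p. z ^ i) = (if z = 1 then of_nat p else 0)"
  using assms by (simp add: geometric_sum)

text \<open>On an eigenvector for \<open>b\<close> the sum is geometric in \<open>b / c\<close>, a
  \<open>p\<close>-th root of unity, hence zero unless \<open>b = c\<close>.\<close>

lemma eigenproj_eigenvec:
  assumes "eigenvec k l b v" "c \<noteq> 0" "c ^ p = b ^ p"
  shows "eigenproj k l p c v j = (if b = c then of_nat p * unroll k v j else 0)"
proof -
  have "eigenproj k l p c v j = (\<Sum>i<p. (b / c) ^ i) * unroll k v j"
    unfolding eigenproj_def sum_distrib_right unroll_eigenvec[OF assms(1)]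
    by (intro sum.cong refl) (simp add: divide_inverse power_mult_distrib power_inverse)
  moreover have "(b / c) ^ p = 1" using assms(2) by (simp add: power_divide flip: assms(3))
  ultimately show ?thesis using assms(2) by (simp add: sum_powers_root_of_unity)
qed

text \<open>A shift by \<open>l\<close> permutes the \<open>p\<close> summands cyclically up to the
  factor \<open>c\<close>: the summand at \<open>p\<close> equals that at \<open>0\<close>, since
  \<open>inverse c ^ p\<close> cancels the sign of a full turn.\<close>

lemma eigenproj_shift:
  assumes v: "v \<in> carrier_vec (p * l)" and pos: "p > 0" "l > 0"
    and c: "c \<noteq> 0" "c ^ p = (-1) ^ (k - 1)"
  shows "eigenproj k l p c v (j + l) = c * eigenproj k l p c v j"
proof -
  define f where "f i = inverse c ^ i * unroll k v (j + i * l)" for i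
  have "f p = f 0"
    using unroll_period[OF v, of k j 1] pos c
    by (simp add: f_def power_inverse)
  have "eigenproj k l p c v (j + l) = (\<Sum>i<p. c * f (Suc i))"
    unfolding eigenproj_def using c(1) by (intro sum.cong refl) (simp add: f_def add_ac)
  also have "\<dots> = c * (\<Sum>i<p. f (Suc i))" by (simp add: sum_distrib_left)
  also have "(\<Sum>i<p. f (Suc i)) = (\<Sum>i<p. f i)"
    using sum.lessThan_Suc_shift[of f p] \<open>f p = f 0\<close> by simp
  also have "\<dots> = eigenproj k l p c v j" by (simp add: f_def eigenproj_def)
  finally show ?thesis .
qed

lemma det_proportional_columns:
  fixes M :: "complex mat"
  assumes M: "M \<in> carrier_mat k k" and ij: "i < k" "j < k" "i \<noteq> j"
    and colj: "\<And>a. a < k \<Longrightarrow> M $$ (a, j) = c * M $$ (a, i)"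
  shows "Determinant.det M = 0"
proof -
  \<comment> \<open>The relation between columns \<open>i\<close> and \<open>j\<close>, as a left
    kernel vector of the transpose.\<close>
  define y where "y a = (if a = i then c else 0) - (if a = j then 1 else 0)" for a
  have "(\<Sum>a<k. y a * transpose_mat M $$ (a, b)) = 0" if "b < k" for b
  proof -
    have "(\<Sum>a<k. y a * transpose_mat M $$ (a, b)) =
        (\<Sum>a<k. if a = i then c * M $$ (b, i) else 0) - (\<Sum>a<k. if a = j then M $$ (b, j) else 0)"
      unfolding sum_subtractf[symmetric] using M that by (intro sum.cong refl) (use ij(3) in \<open>simp add: y_def\<close>)
    then show ?thesis using ij colj[OF that] by simp
  qed
  moreover have "y j \<noteq> 0" using ij by (simp add: y_def)
  ultimately have "Determinant.det (transpose_mat M) = 0"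
    using det_eq_0_left_kernel[of "transpose_mat M" k] M ij by auto
  then show ?thesis using det_transpose[OF M] by simp
qed

lemma row_multrow:
  assumes "W \<in> carrier_mat k n" "a < k"
  shows "row (multrow i e W) a = (if a = i then e \<cdot>\<^sub>v row W a else row W a)"
  using assms by (intro eq_vecI) (auto simp: mat_multrow_def)

text \<open>The \<open>m\<close>-th power of the exponential is \<open>-1\<close>, and
  \<open>k - 1 - 2 * a\<close> has the parity of \<open>k - 1\<close>. Used with
  \<open>m = p\<close> for the eigenvalues and with \<open>m = n\<close> for the symmetric
  point.\<close>

lemma root_of_sign:
  assumes "m > 0" "k > 0"
  shows "(exp (of_real pi * \<i> / of_nat m) powi (int k - 1 - 2 * int a)) ^ m = (-1 :: complex) ^ (k - 1)"
proof -
  have r: "exp (of_real pi * \<i> / of_nat m) ^ m = (-1 :: complex)"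
    using assms(1) by (simp add: exp_of_nat_mult[symmetric])
  have "(exp (of_real pi * \<i> / of_nat m) powi (int k - 1 - 2 * int a)) ^ m =
      (exp (of_real pi * \<i> / of_nat m) ^ m :: complex) powi (int k - 1 - 2 * int a)"
    by (simp add: power_int_power power_int_power' mult.commute)
  also have "\<dots> = (-1) powi (int (k - 1) - int (2 * a))"
    unfolding r using assms(2) by (simp add: of_nat_diff)
  also have "\<dots> = (-1) ^ (k - 1)"
    by (subst power_int_diff) (simp_all only: power_int_of_nat, simp_all)
  finally show ?thesis .
qed

section \<open>The prescribed spectrum and matrices of eigenvectors\<close>

locale equally_spaced =
  fixes k l n p :: nat
  assumes k: "2 \<le> k" and l: "2 \<le> l" and n: "n = p * l" and p: "k \<le> p"
begin

lemma n_pos: "n > 0"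
  using k l n p by simp

abbreviation "\<omega> \<equiv> exp (of_real pi * \<i> / of_nat p)"

text \<open>The eigenvalues of the \<open>l\<close>-fold shift on the points of \<open>D\<close>,
  written with the exponents of the q-binomial theorem; the family is closed under inversion, with
  \<open>a\<close> exchanged for \<open>k - 1 - a\<close>.\<close>

definition zeta :: "nat \<Rightarrow> complex" where
  "zeta a = \<omega> powi (int k - 1 - 2 * int a)"

lemma zeta_neq_0: "zeta a \<noteq> 0"
  by (simp add: zeta_def)

lemma zeta_power: "zeta a ^ p = (-1) ^ (k - 1)"
  unfolding zeta_def using k p by (intro root_of_sign) auto

lemma zeta_inj: "zeta a = zeta b \<Longrightarrow> a < k \<Longrightarrow> b < k \<Longrightarrow> a = b"
proof -
  assume eq: "zeta a = zeta b" and ab: "a < k" "b < k"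
  let ?e = "\<lambda>a. of_int (int k - 1 - 2 * int a) * (complex_of_real pi * \<i> / of_nat p)"
  have "exp (?e a) = exp (?e b)"
    using eq by (simp only: zeta_def exp_power_int)
  then obtain m :: int where "?e a = ?e b + of_int (2 * m) * pi * \<i>"
    unfolding exp_eq by blast
  also have "\<dots> = of_int (int k - 1 - 2 * int b + 2 * m * int p) * (complex_of_real pi * \<i> / of_nat p)"
  proof -
    have "p \<noteq> 0" using k p by simp
    then show ?thesis by (simp add: field_simps)
  qed
  finally have "of_int (int k - 1 - 2 * int a) = (of_int (int k - 1 - 2 * int b + 2 * m * int p) :: complex)"
    unfolding mult_cancel_right using k p by simp
  then have "int k - 1 - 2 * int a = int k - 1 - 2 * int b + 2 * m * int p"
    by (simp only: of_int_eq_iff)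
  then have *: "int b - int a = m * int p" by simp
  \<comment> \<open>Two numbers below \<open>k \<le> p\<close> cannot differ by a nonzero multiple
    of \<open>p\<close>.\<close>
  have "m = 0"
  proof (rule ccontr)
    assume "m \<noteq> 0"
    then have "int p \<le> \<bar>m * int p\<bar>"
      using mult_right_mono[of 1 "\<bar>m\<bar>" "int p"] by (simp add: abs_mult)
    then show False using * ab p by linarith
  qed
  then show "a = b" using * by simp
qed

text \<open>The q-binomial theorem at \<open>t = - zeta a\<close>, where one factor of the product
  vanishes.\<close>

lemma zeta_relation:
  assumes "a < k"
  shows "(\<Sum>i\<le>k. ((-1) ^ i * eval_fls (q_binomial k i) \<omega>) * zeta a ^ i) = 0"
proof -
  have "(\<Sum>i\<le>k. ((-1) ^ i * eval_fls (q_binomial k i) \<omega>) * zeta a ^ i) =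
      (\<Sum>i\<le>k. eval_fls (q_binomial k i) \<omega> * (- zeta a) ^ i)"
    by (intro sum.cong refl) (simp add: power_minus[of "zeta a"])
  also have "\<dots> = (\<Prod>j<k. 1 + \<omega> powi (int k - 1 - 2 * int j) * - zeta a)"
    by (rule q_binomial_theorem[symmetric]) simp
  also have "\<dots> = 0"
  proof (rule prod_zero)
    \<comment> \<open>The index \<open>k - 1 - a\<close> has the exponent opposite to that of
      \<open>zeta a\<close>.\<close>
    have "\<omega> powi (int k - 1 - 2 * int (k - 1 - a)) * zeta a = 1"
      unfolding zeta_def using assms by (simp add: power_int_add[symmetric] of_nat_diff)
    then show "\<exists>j\<in>{..<k}. 1 + \<omega> powi (int k - 1 - 2 * int j) * - zeta a = 0"
      using assms by (intro bexI[of _ "k - 1 - a"]) auto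
  qed simp
  finally show ?thesis .
qed

text \<open>A normal form for the points of \<open>D\<close>: one nonzero eigenvector per
  eigenvalue, in a fixed order.\<close>

definition eigenmat :: "complex mat \<Rightarrow> bool" where
  "eigenmat W \<longleftrightarrow> W \<in> carrier_mat k n \<and>
    (\<forall>a<k. row W a \<noteq> 0\<^sub>v n \<and> eigenvec k l (zeta a) (row W a))"

text \<open>Eigenvectors for distinct eigenvalues: the projection for \<open>zeta b\<close>, applied
  to a relation, leaves only its term at \<open>b\<close>.\<close>

lemma eigenmat_rows_indep:
  assumes W: "eigenmat W"
  shows "rows_indep W"
  unfolding rows_indep_def
proof (intro allI impI)
  fix y b assume y: "\<forall>j<dim_col W. (\<Sum>a<dim_row W. y a * W $$ (a, j)) = 0" and b: "b < dim_row W"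
  have car: "W \<in> carrier_mat k n" and bk: "b < k" using W b by (auto simp: eigenmat_def)
  let ?r = "\<lambda>a. unroll k (row W a)"
  have 0: "(\<Sum>a<k. y a * ?r a j) = 0" for j
  proof -
    have "Matrix.vec n (\<lambda>j. \<Sum>a<k. y a * W $$ (a, j)) = 0\<^sub>v n"
      using y car by (intro eq_vecI) auto
    then show ?thesis
      using unroll_combination[OF car n_pos, of y j] n_pos by (simp add: unroll_def)
  qed
  have "y b * ?r b j = 0" for j
  proof -
    have "0 = (\<Sum>i<p. inverse (zeta b) ^ i * (\<Sum>a<k. y a * ?r a (j + i * l)))" by (simp add: 0)
    also have "\<dots> = (\<Sum>a<k. y a * eigenproj k l p (zeta b) (row W a) j)"
      unfolding eigenproj_def sum_distrib_left by (subst sum.swap) (simp add: mult_ac)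
    also have "\<dots> = (\<Sum>a<k. if a = b then y b * (of_nat p * ?r b j) else 0)"
    proof (intro sum.cong refl)
      fix a assume "a \<in> {..<k}"
      then show "y a * eigenproj k l p (zeta b) (row W a) j = (if a = b then y b * (of_nat p * ?r b j) else 0)"
        using W bk zeta_inj[of a b] eigenproj_eigenvec[of k l "zeta a" "row W a" "zeta b" p j]
        by (auto simp: eigenmat_def zeta_neq_0 zeta_power)
    qed
    also have "\<dots> = of_nat p * (y b * ?r b j)" using bk by simp
    finally show ?thesis using k p by simp
  qed
  moreover have "\<exists>j. ?r b j \<noteq> 0"
    using W bk unroll_eq_0_iff[of "row W b" n k] car n_pos by (auto simp: eigenmat_def)
  ultimately show "y b = 0" by auto
qed

lemma eigenmat_full_rank: "eigenmat W \<Longrightarrow> W \<in> full_rank_mats k n"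
  using eigenmat_rows_indep by (simp add: full_rank_mats_iff eigenmat_def)

lemma eigenmat_multrow:
  assumes W: "eigenmat W" and e: "e \<noteq> 0"
  shows "eigenmat (multrow 0 e W)"
  unfolding eigenmat_def
proof (intro conjI allI impI)
  show "multrow 0 e W \<in> carrier_mat k n" using W by (simp add: eigenmat_def)
  fix a assume a: "a < k"
  have car: "W \<in> carrier_mat k n" and nz: "row W a \<noteq> 0\<^sub>v n" and ev: "eigenvec k l (zeta a) (row W a)"
    using W a by (auto simp: eigenmat_def)
  have r: "row W a \<in> carrier_vec n" using row_carrier[of W a] car by simp
  have u: "unroll k (row (multrow 0 e W) a) j = (if a = 0 then e else 1) * unroll k (row W a) j" for j
    unfolding row_multrow[OF car a]
    by (cases "a = 0") (use unroll_smult[OF r n_pos, of k e j] in simp_all)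
  have r': "row (multrow 0 e W) a \<in> carrier_vec n"
    unfolding row_multrow[OF car a] using r by (cases "a = 0") simp_all
  show "row (multrow 0 e W) a \<noteq> 0\<^sub>v n"
    using nz e unfolding unroll_eq_0_iff[OF r n_pos, of k] unroll_eq_0_iff[OF r' n_pos, of k] u by simp
  show "eigenvec k l (zeta a) (row (multrow 0 e W) a)"
    using ev unfolding eigenvec_def u by simp
qed

text \<open>Taken on unrolled rows, so that position \<open>k * l\<close> also makes sense when
  \<open>k = p\<close> and this position lies beyond the last column.\<close>

definition minor :: "nat \<Rightarrow> complex mat \<Rightarrow> complex" where
  "minor s W = Determinant.det (mat k k (\<lambda>(a, b). unroll k (row W a) (skip s b * l)))"

text \<open>In row \<open>a\<close> the entries at positions \<open>i * l\<close> are
  \<open>zeta a ^ i\<close> times the first entry. Hence \<open>zeta_relation\<close> is a linear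
  relation among these \<open>k + 1\<close> columns, with the same coefficients for every row, and
  \<open>minors_of_dependent_columns\<close> applies.\<close>

lemma eigenmat_minor:
  assumes W: "eigenmat W" and s: "s \<le> k"
  shows "minor s W = eval_fls (q_binomial k s) \<omega> * minor k W"
proof -
  let ?u = "\<lambda>a i. unroll k (row W a) (i * l)" and ?c = "\<lambda>i. (-1) ^ i * eval_fls (q_binomial k i) \<omega>"
  have "(\<Sum>i\<le>k. ?c i * ?u a i) = 0" if a: "a < k" for a
  proof -
    have "eigenvec k l (zeta a) (row W a)" using W a by (simp add: eigenmat_def)
    then have "?u a i = zeta a ^ i * unroll k (row W a) 0" for i
      using unroll_eigenvec[of k l "zeta a" "row W a" 0 i] by simp
    then have "(\<Sum>i\<le>k. ?c i * ?u a i) = (\<Sum>i\<le>k. ?c i * zeta a ^ i) * unroll k (row W a) 0"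
      by (simp only: sum_distrib_right mult.assoc)
    then show ?thesis using zeta_relation[OF a] by simp
  qed
  then have "(-1) ^ (k + s) * ?c k * Determinant.det (mat k k (\<lambda>(a, b). ?u a (skip s b))) =
      ?c s * Determinant.det (mat k k (\<lambda>(a, b). ?u a b))"
    by (rule minors_of_dependent_columns[OF _ s])
  moreover have "mat k k (\<lambda>(a, b). ?u a b) = mat k k (\<lambda>(a, b). ?u a (skip k b))"
    by (intro eq_matI) (auto simp: skip_def)
  \<comment> \<open>The coefficient at \<open>k\<close> is \<open>(-1) ^ k\<close>, because
    \<open>q_binomial k k = 1\<close>.\<close>
  ultimately have "(-1) ^ (k + s) * (-1) ^ k * minor s W =
      (-1) ^ s * eval_fls (q_binomial k s) \<omega> * minor k W"
    by (simp add: minor_def)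
  moreover have "(-1) ^ (k + s) * (-1) ^ k = ((-1) ^ s :: complex)"
    by (simp add: power_add mult_ac flip: power_mult_distrib)
  ultimately show ?thesis by simp
qed

lemma T_single_eq: "s \<le> k \<Longrightarrow> T_single k l s = (\<lambda>b. Suc (skip s b * l)) ` {..<k}"
proof -
  assume s: "s \<le> k"
  have "T_single k l s = (\<lambda>j. Suc (j * l)) ` ({..k} - {s})"
    using l by (auto simp: T_single_def)
  also have "\<dots> = (\<lambda>b. Suc (skip s b * l)) ` {..<k}"
    unfolding skip_image[OF s, symmetric] by (simp add: image_image)
  finally show ?thesis .
qed

text \<open>Makes the denominator the case \<open>s = k\<close> of the numerator, so that both are
  handled through \<open>minor\<close>.\<close>

lemma T_empty_eq: "T_empty k l = T_single k l k"
  using l by (auto simp: T_single_def T_empty_def image_iff)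

text \<open>If \<open>s = k\<close> or \<open>k < p\<close>, all indices are at most
  \<open>n\<close> and neither reduction nor unrolling changes anything. Otherwise
  \<open>k = p\<close> and both sides are zero.\<close>

lemma eval_T_single:
  assumes W: "W \<in> carrier_mat k n" and s: "1 \<le> s" "s \<le> k"
  shows "eval_poly (plucker W) (plucker_var n (T_single k l s)) = minor s W"
proof (cases "s = k \<or> k < p")
  case True
  have less: "skip s b * l < n" if "b < k" for b
    using that True s p l unfolding n skip_def by auto
  let ?r = "\<lambda>i. (i - 1) mod n + 1"
  have id: "?r i = i" if "i \<in> T_single k l s" for i
    using that less unfolding T_single_eq[OF s(2)] by auto
  then have "inj_on ?r (T_single k l s)" "?r ` T_single k l s = T_single k l s"
    by (auto simp: inj_on_def)
  then have "eval_poly (plucker W) (plucker_var n (T_single k l s)) = plucker W (T_single k l s)"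
    by (simp add: eval_plucker_var)
  also have "\<dots> = Determinant.det (mat k k (\<lambda>(a, b). W $$ (a, skip s b * l)))"
    unfolding T_single_eq[OF s(2)]
    using l less strict_mono_skip[of s] by (intro plucker_image[OF W]) (auto simp: strict_mono_on_def strict_mono_def)
  also have "\<dots> = minor s W"
    unfolding minor_def using W less
    by (intro arg_cong[of _ _ Determinant.det] eq_matI) (simp_all add: unroll_less)
  finally show ?thesis .
next
  case False
  then have sk: "s < k" and kp: "k = p" using s p by auto
  let ?r = "\<lambda>i. (i - 1) mod n + 1"
  \<comment> \<open>For \<open>k = p\<close> the indices \<open>1\<close> and
    \<open>1 + k * l\<close> agree modulo \<open>n\<close>, so the variable is \<open>0\<close> by
    the convention on repeated indices.\<close>
  have "1 \<in> T_single k l s" "1 + k * l \<in> T_single k l s"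
    using s sk l by (auto simp: T_single_def image_iff intro: bexI[of _ 0])
  moreover have "?r 1 = ?r (1 + k * l)" using n kp by simp
  moreover have "1 \<noteq> 1 + k * l" using k l by simp
  ultimately have "\<not> inj_on ?r (T_single k l s)" unfolding inj_on_def by blast
  then have "eval_poly (plucker W) (plucker_var n (T_single k l s)) = 0"
    by (simp add: eval_plucker_var)
  moreover have "minor s W = 0"
    unfolding minor_def
  \<comment> \<open>As \<open>1 \<le> s < k\<close>, the first and last columns of the minor sit at
    positions \<open>0\<close> and \<open>k * l = n\<close>, hence differ by the sign of one
    turn.\<close>
  proof (rule det_proportional_columns)
    fix a assume a: "a < k"
    have "row W a \<in> carrier_vec n" using row_carrier[of W a] W by simp
    then have "unroll k (row W a) (k * l) = (-1) ^ (k - 1) * unroll k (row W a) 0"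
      using unroll_period[of "row W a" n k 0 1] n_pos n kp by simp
    then show "mat k k (\<lambda>(a, b). unroll k (row W a) (skip s b * l)) $$ (a, k - 1) =
        (-1) ^ (k - 1) * mat k k (\<lambda>(a, b). unroll k (row W a) (skip s b * l)) $$ (a, 0)"
      using a s sk by (simp add: skip_def)
  qed (use k in auto)
  ultimately show ?thesis by simp
qed

end

section \<open>Eigenvalues on a connected component\<close>

definition has_eigenvec :: "nat \<Rightarrow> nat \<Rightarrow> nat \<Rightarrow> complex Matrix.vec set \<Rightarrow> complex \<Rightarrow> bool" where
  "has_eigenvec k n l V c \<longleftrightarrow> (\<exists>v\<in>V. v \<noteq> 0\<^sub>v n \<and> eigenvec k l c v)"

definition comb :: "complex mat \<Rightarrow> (nat \<Rightarrow> complex) \<Rightarrow> complex Matrix.vec" where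
  "comb A y = Matrix.vec (dim_col A) (\<lambda>j. \<Sum>a<dim_row A. y a * A $$ (a, j))"

lemma row_span_comb: "row_span A = range (comb A)"
  using row_span_iff[of A "dim_row A" "dim_col A"] by (auto simp: comb_def)

lemma comb_carrier: "A \<in> carrier_mat k n \<Longrightarrow> comb A y \<in> carrier_vec n"
  by (auto simp: comb_def)

lemma unroll_comb:
  "A \<in> carrier_mat k n \<Longrightarrow> n > 0 \<Longrightarrow> unroll k (comb A y) j = (\<Sum>a<k. y a * unroll k (row A a) j)"
  using unroll_combination[of A k n y j] by (simp add: comb_def)

lemma comb_unit:
  assumes "A \<in> carrier_mat k n" "a < k"
  shows "comb A (\<lambda>b. if b = a then 1 else 0) = row A a"
proof (rule eq_vecI)
  fix j assume "j < dim_vec (row A a)"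
  moreover have "(\<Sum>b<k. (if b = a then 1 else 0) * A $$ (b, j)) = (\<Sum>b<k. if b = a then A $$ (a, j) else 0)"
    by (intro sum.cong) auto
  ultimately show "vec_index (comb A (\<lambda>b. if b = a then 1 else 0)) j = vec_index (row A a) j"
    using assms by (simp add: comb_def)
qed (use assms in \<open>simp add: comb_def\<close>)

lemma comb_eq_0_iff:
  assumes "A \<in> carrier_mat k n" "rows_indep A"
  shows "comb A y = 0\<^sub>v n \<longleftrightarrow> (\<forall>a<k. y a = 0)"
proof
  assume 0: "comb A y = 0\<^sub>v n"
  have "(\<Sum>a<k. y a * A $$ (a, j)) = 0" if "j < n" for j
    using arg_cong[OF 0, of "\<lambda>v. vec_index v j"] assms(1) that by (simp add: comb_def)
  then show "\<forall>a<k. y a = 0" using assms by (auto simp: rows_indep_def)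
qed (use assms in \<open>auto simp: comb_def intro!: eq_vecI\<close>)

lemma Gr_row_span: "A \<in> full_rank_mats k n \<Longrightarrow> row_span A \<in> Gr k n"
  by (simp add: Gr_def)

text \<open>A sequence with the right behaviour under translation by \<open>n\<close> is recovered
  from its first \<open>n\<close> values.\<close>

lemma unroll_vec:
  assumes "\<And>j. f (j + n) = (-1) ^ (k - 1) * f j" "n > 0"
  shows "unroll k (Matrix.vec n f) j = f j"
proof -
  have "f (i + n * m) = (-1) ^ ((k - 1) * m) * f i" for i m
  proof (induction m)
    case (Suc m)
    have "f (i + n * Suc m) = f ((i + n * m) + n)" by (simp add: add_ac)
    then show ?case using Suc assms(1) by (simp add: power_add)
  qed simp
  from this[of "j mod n" "j div n"] show ?thesis
    using assms(2) by (simp add: unroll_def)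
qed

text \<open>Sequential criterion for openness. If every radius \<open>1 / (m + 1)\<close> fails, the
  counterexamples form a convergent sequence avoiding \<open>U\<close> altogether, so a single term
  in \<open>U\<close> suffices for a contradiction.\<close>

lemma Gr_open_seqI:
  assumes "U \<subseteq> Gr k n"
    and seq: "\<And>A Bs. A \<in> full_rank_mats k n \<Longrightarrow> row_span A \<in> U \<Longrightarrow> (\<And>m::nat. Bs m \<in> full_rank_mats k n) \<Longrightarrow>
      (\<And>i j. i < k \<Longrightarrow> j < n \<Longrightarrow> (\<lambda>m. Bs m $$ (i, j)) \<longlonglongrightarrow> A $$ (i, j)) \<Longrightarrow> \<exists>m. row_span (Bs m) \<in> U"
  shows "Gr_open k n U"
  unfolding Gr_open_def
proof (intro conjI ballI impI)
  fix A assume A: "A \<in> full_rank_mats k n" "row_span A \<in> U"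
  show "\<exists>e>0. \<forall>B\<in>full_rank_mats k n.
      (\<forall>i<k. \<forall>j<n. dist (B $$ (i, j)) (A $$ (i, j)) < e) \<longrightarrow> row_span B \<in> U"
  proof (rule ccontr)
    assume neg: "\<not> ?thesis"
    have "\<exists>B. B \<in> full_rank_mats k n \<and>
        (\<forall>i<k. \<forall>j<n. dist (B $$ (i, j)) (A $$ (i, j)) < inverse (real (Suc m))) \<and> row_span B \<notin> U" for m
    proof -
      have "inverse (real (Suc m)) > 0" by simp
      with neg show ?thesis by blast
    qed
    then obtain Bs where Bs: "\<And>m. Bs m \<in> full_rank_mats k n"
      "\<And>m i j. i < k \<Longrightarrow> j < n \<Longrightarrow> dist (Bs m $$ (i, j)) (A $$ (i, j)) < inverse (real (Suc m))"
      "\<And>m. row_span (Bs m) \<notin> U" by metis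
    have lim: "(\<lambda>m. Bs m $$ (i, j)) \<longlonglongrightarrow> A $$ (i, j)" if "i < k" "j < n" for i j
    proof (subst tendsto_dist_iff, rule tendsto_sandwich[OF _ _ tendsto_const LIMSEQ_inverse_real_of_nat])
      show "\<forall>\<^sub>F m in sequentially. 0 \<le> dist (Bs m $$ (i, j)) (A $$ (i, j))" by simp
      show "\<forall>\<^sub>F m in sequentially. dist (Bs m $$ (i, j)) (A $$ (i, j)) \<le> inverse (real (Suc m))"
        by (rule always_eventually, rule allI, rule less_imp_le, rule Bs(2)[OF that])
    qed
    have "\<exists>m. row_span (Bs m) \<in> U" by (rule seq[OF A Bs(1)], rule lim)
    then show False using Bs(3) by blast
  qed
qed fact

lemma tendsto_det:
  assumes "\<And>m. F m \<in> carrier_mat k k" "G \<in> carrier_mat k k"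
    and "\<And>i j. i < k \<Longrightarrow> j < k \<Longrightarrow> ((\<lambda>m. F m $$ (i, j)) \<longlongrightarrow> (G $$ (i, j) :: complex)) H"
  shows "((\<lambda>m. Determinant.det (F m)) \<longlongrightarrow> Determinant.det G) H"
  unfolding det_def'[OF assms(1)] det_def'[OF assms(2)]
proof (intro tendsto_sum tendsto_mult tendsto_const tendsto_prod)
  fix q i assume "q \<in> {q. q permutes {0..<k}}" "i \<in> {0..<k}"
  then show "((\<lambda>m. F m $$ (i, q i)) \<longlongrightarrow> G $$ (i, q i)) H"
    using permutes_in_image[of q "{0..<k}" i] by (intro assms(3)) auto
qed

lemma tendsto_unroll_row:
  assumes "\<And>m. Bs m \<in> carrier_mat k n" "A \<in> carrier_mat k n" "n > 0" "a < k"
    and "\<And>i j. i < k \<Longrightarrow> j < n \<Longrightarrow> ((\<lambda>m. Bs m $$ (i, j)) \<longlongrightarrow> A $$ (i, j)) H"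
  shows "((\<lambda>m. unroll k (row (Bs m) a) j) \<longlongrightarrow> unroll k (row A a) j) H"
proof -
  have "unroll k (row B a) j = (-1) ^ ((k - 1) * (j div n)) * B $$ (a, j mod n)" if "B \<in> carrier_mat k n" for B
    using that assms(3,4) by (simp add: unroll_def)
  then show ?thesis using assms by (simp add: tendsto_mult)
qed

lemma eigenproj_comb:
  assumes "A \<in> carrier_mat k n" "n > 0"
  shows "eigenproj k l p c (comb A y) j = (\<Sum>a<k. y a * eigenproj k l p c (row A a) j)"
  unfolding eigenproj_def unroll_comb[OF assms] sum_distrib_left
  by (subst sum.swap) (simp add: mult_ac)

text \<open>If the projection is nonzero on the span, it is nonzero on some row at some position,
  and that value depends continuously on the matrix.\<close>

lemma Gr_open_eigenproj:
  assumes n: "n > 0"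
  shows "Gr_open k n {V \<in> Gr k n. \<exists>v\<in>V. \<exists>j. eigenproj k l p c v j \<noteq> 0}"
proof (rule Gr_open_seqI)
  fix A and Bs :: "nat \<Rightarrow> complex mat"
  assume A: "A \<in> full_rank_mats k n" "row_span A \<in> {V \<in> Gr k n. \<exists>v\<in>V. \<exists>j. eigenproj k l p c v j \<noteq> 0}"
    and Bs: "\<And>m. Bs m \<in> full_rank_mats k n"
    and lim: "\<And>i j. i < k \<Longrightarrow> j < n \<Longrightarrow> (\<lambda>m. Bs m $$ (i, j)) \<longlonglongrightarrow> A $$ (i, j)"
  have car: "A \<in> carrier_mat k n" "\<And>m. Bs m \<in> carrier_mat k n"
    using A(1) Bs by (auto simp: full_rank_mats_def)
  obtain y j where "eigenproj k l p c (comb A y) j \<noteq> 0"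
    using A(2) by (auto simp: row_span_comb)
  then obtain a where a: "a < k" "eigenproj k l p c (row A a) j \<noteq> 0"
    unfolding eigenproj_comb[OF car(1) n]
    by (metis (no_types, lifting) lessThan_iff mult_zero_right sum.neutral)
  have "(\<lambda>m. eigenproj k l p c (row (Bs m) a) j) \<longlonglongrightarrow> eigenproj k l p c (row A a) j"
    unfolding eigenproj_def
    by (intro tendsto_sum tendsto_mult tendsto_const tendsto_unroll_row[OF car(2) car(1) n a(1) lim])
  then have "\<forall>\<^sub>F m in sequentially. eigenproj k l p c (row (Bs m) a) j \<noteq> 0"
    using a(2) by (rule tendsto_imp_eventually_ne)
  then obtain m where "eigenproj k l p c (row (Bs m) a) j \<noteq> 0"
    using eventually_happens trivial_limit_sequentially by blast
  moreover have "row (Bs m) a \<in> row_span (Bs m)"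
    unfolding row_span_comb using comb_unit[OF car(2) a(1)] by (metis rangeI)
  ultimately show "\<exists>m. row_span (Bs m) \<in> {V \<in> Gr k n. \<exists>v\<in>V. \<exists>j. eigenproj k l p c v j \<noteq> 0}"
    using Gr_row_span[OF Bs] by blast
qed auto

text \<open>The operator "\<open>l\<close>-fold shift minus \<open>c\<close>" applied to every row
  of \<open>A\<close>.\<close>

definition shift_minus :: "nat \<Rightarrow> complex \<Rightarrow> complex mat \<Rightarrow> complex mat" where
  "shift_minus l c A = mat (dim_row A) (dim_col A)
    (\<lambda>(a, j). unroll (dim_row A) (row A a) (j + l) - c * unroll (dim_row A) (row A a) j)"

text \<open>A relation among the rows of \<open>shift_minus l c A\<close> is a combination of the
  rows of \<open>A\<close> killed by the shift minus \<open>c\<close>, that is, an eigenvector or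
  zero.\<close>

lemma rows_indep_shift_minus:
  assumes A: "A \<in> full_rank_mats k n" and n: "n > 0"
  shows "rows_indep (shift_minus l c A) \<longleftrightarrow> \<not> has_eigenvec k n l (row_span A) c"
proof -
  have car: "A \<in> carrier_mat k n" and ind: "rows_indep A" using A by (auto simp: full_rank_mats_iff)
  let ?f = "\<lambda>y j. unroll k (comb A y) (j + l) - c * unroll k (comb A y) j"
  \<comment> \<open>This behaviour under translation by \<open>n\<close> lets the equations for
    \<open>j < n\<close> imply those for all \<open>j\<close>.\<close>
  have "?f y (j + n) = (-1) ^ (k - 1) * ?f y j" for y j
    using unroll_period[OF comb_carrier[OF car, of y] n, of k j 1]
      unroll_period[OF comb_carrier[OF car, of y] n, of k "j + l" 1]
    by (simp add: algebra_simps)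
  then have f: "unroll k (Matrix.vec n (?f y)) j = ?f y j" for y j using n by (rule unroll_vec)
  have all: "(\<forall>j<n. ?f y j = 0) \<longleftrightarrow> eigenvec k l c (comb A y)" for y
  proof
    assume "\<forall>j<n. ?f y j = 0"
    then have "Matrix.vec n (?f y) = 0\<^sub>v n" by (intro eq_vecI) auto
    then have "?f y j = 0" for j using f[of y j] n by (simp add: unroll_def)
    then show "eigenvec k l c (comb A y)" by (simp add: eigenvec_def)
  qed (simp add: eigenvec_def)
  have "(\<Sum>a<k. y a * shift_minus l c A $$ (a, j)) = ?f y j" if "j < n" for y j
  proof -
    have "(\<Sum>a<k. y a * shift_minus l c A $$ (a, j)) =
        (\<Sum>a<k. y a * unroll k (row A a) (j + l) - c * (y a * unroll k (row A a) j))"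
      using car that by (intro sum.cong) (auto simp: shift_minus_def algebra_simps)
    then show ?thesis by (simp add: unroll_comb[OF car n] sum_subtractf sum_distrib_left)
  qed
  then have "rows_indep (shift_minus l c A) \<longleftrightarrow> (\<forall>y. (\<forall>j<n. ?f y j = 0) \<longrightarrow> comb A y = 0\<^sub>v n)"
    using car by (simp add: rows_indep_def comb_eq_0_iff[OF car ind] shift_minus_def)
  then show ?thesis unfolding all by (auto simp: has_eigenvec_def row_span_comb)
qed

text \<open>The absence of the eigenvalue \<open>c\<close> is the nonvanishing of the Gram
  determinant of \<open>shift_minus l c A\<close>, which is continuous in the entries of
  \<open>A\<close>.\<close>

lemma Gr_open_no_eigenvec:
  assumes n: "n > 0"
  shows "Gr_open k n {V \<in> Gr k n. \<not> has_eigenvec k n l V c}"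
proof (rule Gr_open_seqI)
  fix A and Bs :: "nat \<Rightarrow> complex mat"
  assume A: "A \<in> full_rank_mats k n" "row_span A \<in> {V \<in> Gr k n. \<not> has_eigenvec k n l V c}"
    and Bs: "\<And>m. Bs m \<in> full_rank_mats k n"
    and lim: "\<And>i j. i < k \<Longrightarrow> j < n \<Longrightarrow> (\<lambda>m. Bs m $$ (i, j)) \<longlonglongrightarrow> A $$ (i, j)"
  have car: "A \<in> carrier_mat k n" "\<And>m. Bs m \<in> carrier_mat k n"
    using A(1) Bs by (auto simp: full_rank_mats_def)
  have S: "shift_minus l c B \<in> carrier_mat k n" if "B \<in> carrier_mat k n" for B
    using that by (auto simp: shift_minus_def)
  have lim': "(\<lambda>m. shift_minus l c (Bs m) $$ (a, j)) \<longlonglongrightarrow> shift_minus l c A $$ (a, j)"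
    if aj: "a < k" "j < n" for a j
  proof -
    have eq: "shift_minus l c B $$ (a, j) = unroll k (row B a) (j + l) - c * unroll k (row B a) j"
      if "B \<in> carrier_mat k n" for B using that aj by (auto simp: shift_minus_def)
    show ?thesis unfolding eq[OF car(1)] eq[OF car(2)]
      by (intro tendsto_diff tendsto_mult tendsto_const tendsto_unroll_row[OF car(2) car(1) n aj(1) lim])
  qed
  have "(\<lambda>m. Determinant.det (gram (shift_minus l c (Bs m)))) \<longlonglongrightarrow> Determinant.det (gram (shift_minus l c A))"
  proof (rule tendsto_det)
    show "gram (shift_minus l c (Bs m)) \<in> carrier_mat k k" for m by (rule gram_carrier[OF S[OF car(2)]])
    show "gram (shift_minus l c A) \<in> carrier_mat k k" by (rule gram_carrier[OF S[OF car(1)]])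
    fix i j assume ij: "i < k" "j < k"
    show "(\<lambda>m. gram (shift_minus l c (Bs m)) $$ (i, j)) \<longlonglongrightarrow> gram (shift_minus l c A) $$ (i, j)"
      unfolding gram_index[OF S[OF car(1)] ij] gram_index[OF S[OF car(2)] ij]
      using ij by (intro tendsto_sum tendsto_mult tendsto_cnj lim') auto
  qed
  moreover have "Determinant.det (gram (shift_minus l c A)) \<noteq> 0"
    using A rows_indep_shift_minus[OF A(1) n] rows_indep_iff_gram[OF S[OF car(1)]] by auto
  ultimately have "\<forall>\<^sub>F m in sequentially. Determinant.det (gram (shift_minus l c (Bs m))) \<noteq> 0"
    by (rule tendsto_imp_eventually_ne)
  then obtain m where "Determinant.det (gram (shift_minus l c (Bs m))) \<noteq> 0"
    using eventually_happens trivial_limit_sequentially by blast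
  then have "\<not> has_eigenvec k n l (row_span (Bs m)) c"
    using rows_indep_shift_minus[OF Bs n] rows_indep_iff_gram[OF S[OF car(2)]] by auto
  then show "\<exists>m. row_span (Bs m) \<in> {V \<in> Gr k n. \<not> has_eigenvec k n l V c}"
    using Gr_row_span[OF Bs] by blast
qed auto

section \<open>The spectrum on the fixed locus\<close>

context equally_spaced
begin

lemma fixed_locus_iff: "V \<in> fixed_locus k n l \<longleftrightarrow> V \<in> Gr k n \<and> (shift_vec k ^^ l) ` V = V"
  by (simp add: fixed_locus_def cyclic_shift_pow)

text \<open>The \<open>l\<close>-fold shift multiplies the coefficients of a combination of rows by
  the nonzero numbers \<open>zeta a\<close>, so it maps the span onto itself.\<close>

lemma eigenmat_fixed_locus:
  assumes W: "eigenmat W"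
  shows "row_span W \<in> fixed_locus k n l"
proof -
  have car: "W \<in> carrier_mat k n" using W by (simp add: eigenmat_def)
  have s: "(shift_vec k ^^ l) (comb W y) = comb W (\<lambda>a. zeta a * y a)" for y
  proof (rule unroll_eqI[where n = n and k = k])
    fix j
    have "unroll k (row W a) (l + j) = zeta a * unroll k (row W a) j" if "a < k" for a
      using W that by (simp add: eigenmat_def eigenvec_def add.commute)
    then show "unroll k ((shift_vec k ^^ l) (comb W y)) j = unroll k (comb W (\<lambda>a. zeta a * y a)) j"
      by (simp add: unroll_shift_vec_pow[OF comb_carrier[OF car] n_pos] unroll_comb[OF car n_pos] mult_ac)
  qed (simp_all add: shift_vec_carrier comb_carrier[OF car])
  have "(shift_vec k ^^ l) ` row_span W = row_span W"
  proof (intro equalityI subsetI)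
    fix v assume "v \<in> row_span W"
    then obtain y where "v = comb W y" unfolding row_span_comb by auto
    then have "v = (shift_vec k ^^ l) (comb W (\<lambda>a. y a / zeta a))"
      unfolding s by (simp add: zeta_neq_0)
    then show "v \<in> (shift_vec k ^^ l) ` row_span W" unfolding row_span_comb by blast
  qed (auto simp: row_span_comb s)
  then show ?thesis
    using Gr_row_span[OF eigenmat_full_rank[OF W]] by (simp add: fixed_locus_iff)
qed

lemma eigenmat_has_eigenvec: "eigenmat W \<Longrightarrow> a < k \<Longrightarrow> has_eigenvec k n l (row_span W) (zeta a)"
  using comb_unit[of W k n a] unfolding has_eigenvec_def eigenmat_def row_span_comb
  by (metis rangeI)

text \<open>Rephrases the existence of an eigenvector as a condition that is open. In the harder
  direction the projection of \<open>v\<close> is itself the eigenvector sought.\<close>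

lemma has_eigenvec_iff_eigenproj:
  assumes V: "V \<in> fixed_locus k n l" and c: "c \<noteq> 0" "c ^ p = (-1) ^ (k - 1)"
  shows "has_eigenvec k n l V c \<longleftrightarrow> (\<exists>v\<in>V. \<exists>j. eigenproj k l p c v j \<noteq> 0)"
proof -
  obtain A where A: "A \<in> full_rank_mats k n" "V = row_span A" and stable: "(shift_vec k ^^ l) ` V = V"
    using V by (auto simp: fixed_locus_iff Gr_def)
  have car: "A \<in> carrier_mat k n" using A by (simp add: full_rank_mats_def)
  have Vc: "v \<in> carrier_vec n" if "v \<in> V" for v
    using that comb_carrier[OF car] by (auto simp: A(2) row_span_comb)
  show ?thesis
  proof
    assume "has_eigenvec k n l V c"
    then obtain v where v: "v \<in> V" "v \<noteq> 0\<^sub>v n" "eigenvec k l c v" by (auto simp: has_eigenvec_def)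
    then obtain j where "unroll k v j \<noteq> 0" using unroll_eq_0_iff[OF Vc n_pos] by blast
    then have "eigenproj k l p c v j \<noteq> 0" using eigenproj_eigenvec[OF v(3) c(1)] k p by simp
    then show "\<exists>v\<in>V. \<exists>j. eigenproj k l p c v j \<noteq> 0" using v(1) by blast
  next
    assume "\<exists>v\<in>V. \<exists>j. eigenproj k l p c v j \<noteq> 0"
    then obtain v j where v: "v \<in> V" and j: "eigenproj k l p c v j \<noteq> 0" by blast
    define w where "w = Matrix.vec n (eigenproj k l p c v)"
    have "unroll k v (j + n) = (-1) ^ (k - 1) * unroll k v j" for j
      using unroll_period[OF Vc[OF v] n_pos, of k j 1] by simp
    then have "unroll k v (j + n + i * l) = (-1) ^ (k - 1) * unroll k v (j + i * l)" for i j
      by (metis add.assoc add.commute)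
    then have "eigenproj k l p c v (j + n) = (-1) ^ (k - 1) * eigenproj k l p c v j" for j
      unfolding eigenproj_def by (simp add: sum_distrib_left mult_ac)
    then have w: "unroll k w j = eigenproj k l p c v j" for j
      unfolding w_def using n_pos by (rule unroll_vec)
    have wc: "w \<in> carrier_vec n" by (simp add: w_def)
    have "w \<noteq> 0\<^sub>v n" using j unfolding unroll_eq_0_iff[OF wc n_pos, of k] w by blast
    moreover have "eigenvec k l c w"
      unfolding eigenvec_def w using Vc[OF v] c k p l n by (intro allI eigenproj_shift) auto
    \<comment> \<open>The projection is a linear combination of iterated shifts of \<open>v\<close>,
      all of which stay in the stable subspace \<open>V\<close>.\<close>
    moreover have "w \<in> V"
    proof -
      have "((shift_vec k ^^ l) ^^ i) v \<in> V" for i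
        by (induction i) (use v stable in auto)
      then have "\<exists>y. ((shift_vec k ^^ l) ^^ i) v = comb A y" for i
        unfolding A(2) row_span_comb by auto
      then obtain Y where Y: "\<And>i. ((shift_vec k ^^ l) ^^ i) v = comb A (Y i)" by metis
      have Yu: "unroll k v (j + i * l) = (\<Sum>a<k. Y i a * unroll k (row A a) j)" for i j
        unfolding unroll_comb[OF car n_pos, symmetric] Y[symmetric] funpow_mult
        by (simp add: unroll_shift_vec_pow[OF Vc[OF v] n_pos] add.commute mult.commute)
      have "w = comb A (\<lambda>a. \<Sum>i<p. inverse c ^ i * Y i a)"
      proof (rule unroll_eqI[OF wc comb_carrier[OF car], where k = k])
        fix j
        show "unroll k w j = unroll k (comb A (\<lambda>a. \<Sum>i<p. inverse c ^ i * Y i a)) j"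
          unfolding w eigenproj_def Yu unroll_comb[OF car n_pos] sum_distrib_left sum_distrib_right
          by (subst sum.swap) (simp add: mult_ac)
      qed
      then show ?thesis unfolding A(2) row_span_comb by blast
    qed
    ultimately show "has_eigenvec k n l V c" by (auto simp: has_eigenvec_def)
  qed
qed

text \<open>Eigenvectors for all \<open>zeta a\<close> are taken as the rows of
  \<open>W = Q * A\<close>. They are independent, so \<open>Q\<close> is invertible and affects the
  Plucker coordinates only by the factor \<open>det Q\<close>.\<close>

lemma eigenmat_of_eigenvecs:
  assumes A: "A \<in> full_rank_mats k n" and eig: "\<And>a. a < k \<Longrightarrow> has_eigenvec k n l (row_span A) (zeta a)"
  obtains W where "eigenmat W" "\<And>I. I \<in> index_sets k n \<Longrightarrow> plucker W I = plucker A I"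
proof -
  have car: "A \<in> carrier_mat k n" using A by (simp add: full_rank_mats_def)
  have "\<exists>y. comb A y \<noteq> 0\<^sub>v n \<and> eigenvec k l (zeta a) (comb A y)" if "a < k" for a
    using eig[OF that] by (auto simp: has_eigenvec_def row_span_comb)
  then obtain Y where Y: "\<And>a. a < k \<Longrightarrow> comb A (Y a) \<noteq> 0\<^sub>v n"
    "\<And>a. a < k \<Longrightarrow> eigenvec k l (zeta a) (comb A (Y a))" by metis
  define Q where "Q = mat k k (\<lambda>(a, b). Y a b)"
  define W where "W = Q * A"
  have Q: "Q \<in> carrier_mat k k" by (simp add: Q_def)
  have Wc: "W \<in> carrier_mat k n" using Q car by (simp add: W_def)
  have row: "row W a = comb A (Y a)" if "a < k" for a
    using that car by (intro eq_vecI) (auto simp: W_def Q_def comb_def scalar_prod_def atLeast0LessThan)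
  have W: "eigenmat W" using Wc row Y by (simp add: eigenmat_def)
  have d: "Determinant.det Q \<noteq> 0"
  proof
    assume "Determinant.det Q = 0"
    then obtain y a where y: "a < k" "y a \<noteq> 0" "\<And>b. b < k \<Longrightarrow> (\<Sum>a<k. y a * Q $$ (a, b)) = 0"
      unfolding det_eq_0_left_kernel[OF Q] by auto
    have "(\<Sum>a<k. y a * W $$ (a, j)) = 0" if "j < n" for j
    proof -
      have "(\<Sum>a<k. y a * W $$ (a, j)) = (\<Sum>a<k. \<Sum>b<k. y a * Q $$ (a, b) * A $$ (b, j))"
        using car Q that
        by (intro sum.cong refl) (simp add: W_def scalar_prod_def atLeast0LessThan sum_distrib_left mult.assoc)
      also have "\<dots> = (\<Sum>b<k. (\<Sum>a<k. y a * Q $$ (a, b)) * A $$ (b, j))"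
        by (subst sum.swap) (simp add: sum_distrib_right)
      finally show ?thesis using y(3) by simp
    qed
    then show False using eigenmat_rows_indep[OF W] Wc y(1,2) by (auto simp: rows_indep_def)
  qed
  \<comment> \<open>Rescaling one row by this number makes the Plucker coordinates equal rather than
    proportional, as is needed for polynomials that may be inhomogeneous.\<close>
  let ?e = "inverse (Determinant.det Q)"
  have "plucker (multrow 0 ?e W) I = plucker A I" if I: "I \<in> index_sets k n" for I
  proof -
    have "multrow 0 ?e W = multrow_mat k 0 ?e * W" by (rule multrow_mat[OF Wc])
    then have "plucker (multrow 0 ?e W) I = ?e * plucker W I"
      using plucker_mult_left[OF _ Wc I, of "multrow_mat k 0 ?e"] k by (simp add: det_multrow_mat)
    then show ?thesis using plucker_mult_left[OF Q car I] d by (simp add: W_def)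
  qed
  moreover have "eigenmat (multrow 0 ?e W)" using W d by (intro eigenmat_multrow) auto
  ultimately show ?thesis using that by blast
qed

text \<open>Having the eigenvalue \<open>zeta a\<close> is both open and closed in the fixed locus,
  so a connected component containing one such point consists of such points.\<close>

lemma component_has_eigenvecs:
  assumes D: "D \<in> connected_components_of (subtopology (Gr_topology k n) (fixed_locus k n l))"
    and W: "eigenmat W" "row_span W \<in> D" and V: "V \<in> D" and a: "a < k"
  shows "has_eigenvec k n l V (zeta a)"
proof -
  let ?X = "subtopology (Gr_topology k n) (fixed_locus k n l)"
  let ?S = "{V \<in> fixed_locus k n l. has_eigenvec k n l V (zeta a)}"
  have sub: "fixed_locus k n l \<subseteq> Gr k n" by (auto simp: fixed_locus_def)
  have top: "topspace ?X = fixed_locus k n l" using sub by (auto simp: topspace_Gr_topology)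
  have "?S = fixed_locus k n l \<inter> {V \<in> Gr k n. \<exists>v\<in>V. \<exists>j. eigenproj k l p (zeta a) v j \<noteq> 0}"
    using sub has_eigenvec_iff_eigenproj[OF _ zeta_neq_0 zeta_power] by blast
  then have "openin ?X ?S"
    unfolding openin_subtopology_alt openin_Gr_topology
    using Gr_open_eigenproj[OF n_pos] by (intro image_eqI) auto
  moreover have "fixed_locus k n l - ?S = fixed_locus k n l \<inter> {V \<in> Gr k n. \<not> has_eigenvec k n l V (zeta a)}"
    using sub by auto
  then have "openin ?X (topspace ?X - ?S)"
    unfolding top openin_subtopology_alt openin_Gr_topology
    using Gr_open_no_eigenvec[OF n_pos] by (intro image_eqI) auto
  then have "closedin ?X ?S" unfolding closedin_def using top by blast
  ultimately have "D \<subseteq> ?S \<or> disjnt D ?S"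
    using connectedin_clopen_cases[OF connectedin_connected_components_of[OF D]] by blast
  moreover have "row_span W \<in> D \<inter> ?S"
    using W eigenmat_fixed_locus eigenmat_has_eigenvec a by auto
  ultimately show ?thesis using V by (auto simp: disjnt_iff)
qed

end

section \<open>A symmetric Vandermonde determinant\<close>

text \<open>Scaling the columns is multiplication on the right by a diagonal matrix.\<close>

lemma det_column_scale:
  fixes M :: "nat \<Rightarrow> nat \<Rightarrow> complex"
  shows "Determinant.det (mat k k (\<lambda>(a, b). c b * M a b)) = (\<Prod>b<k. c b) * Determinant.det (mat k k (\<lambda>(a, b). M a b))"
proof -
  let ?E = "mat k k (\<lambda>(a, b). if a = b then c b else 0)" and ?M = "mat k k (\<lambda>(a, b). M a b)"
  have "mat k k (\<lambda>(a, b). c b * M a b) = ?M * ?E"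
  proof (rule eq_matI)
    fix a b assume "a < dim_row (?M * ?E)" "b < dim_col (?M * ?E)"
    then have ab: "a < k" "b < k" by auto
    then have "(?M * ?E) $$ (a, b) = (\<Sum>i<k. M a i * (if i = b then c b else 0))"
      by (simp add: scalar_prod_def atLeast0LessThan)
    also have "\<dots> = (\<Sum>i<k. if i = b then M a b * c b else 0)"
      by (intro sum.cong) auto
    finally show "mat k k (\<lambda>(a, b). c b * M a b) $$ (a, b) = (?M * ?E) $$ (a, b)"
      using ab by simp
  qed auto
  moreover have "Determinant.det ?E = (\<Prod>b<k. c b)"
  proof -
    have "diag_mat ?E = map c [0..<k]" by (auto simp: diag_mat_def)
    moreover have "upper_triangular ?E" by (auto simp: upper_triangular_def)
    moreover have "prod_list (map c [0..<k]) = (\<Prod>b<k. c b)"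
      by (simp add: prod.list_conv_set_nth atLeast0LessThan)
    ultimately show ?thesis using det_upper_triangular[of ?E k] by simp
  qed
  ultimately show ?thesis by (simp add: det_mult[of _ k] mult.commute)
qed

text \<open>Subtracting \<open>x\<^sub>k\<^sup>2\<close> times the next row from each row clears the last column, and leaves a
  column-scaled copy of the matrix of size \<open>k\<close>.\<close>

lemma det_symmetric_vandermonde:
  fixes x :: "nat \<Rightarrow> complex"
  assumes "\<And>b. x b \<noteq> 0"
  shows "Determinant.det (mat k k (\<lambda>(a, b). x b powi (int k - 1 - 2 * int a))) =
    (\<Prod>b<k. \<Prod>a<b. x a / x b - x b / x a)"
proof (induction k)
  case 0
  show ?case by (simp add: det_def)
next
  case (Suc k)
  let ?M = "mat (Suc k) (Suc k) (\<lambda>(a, b). x b powi (int (Suc k) - 1 - 2 * int a))"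
  define U where "U = mat (Suc k) (Suc k) (\<lambda>(a, b). if a = b then 1 else if b = Suc a then - (x k)\<^sup>2 else 0)"
  have car: "U \<in> carrier_mat (Suc k) (Suc k)" "?M \<in> carrier_mat (Suc k) (Suc k)" by (auto simp: U_def)
  have detU: "Determinant.det U = 1"
  proof -
    have "diag_mat U = replicate (Suc k) 1"
      by (intro nth_equalityI) (auto simp: diag_mat_def U_def simp del: upt_Suc replicate_Suc)
    moreover have "upper_triangular U" by (auto simp: upper_triangular_def U_def)
    ultimately show ?thesis using det_upper_triangular[OF _ car(1)] by simp
  qed
  have UM: "(U * ?M) $$ (a, b) = x k * (x b / x k - x k / x b) * x b powi (int k - 1 - 2 * int a)"
    if ab: "a < k" "b < Suc k" for a b
  proof -
    have "(U * ?M) $$ (a, b) = (\<Sum>i<Suc k. U $$ (a, i) * x b powi (int (Suc k) - 1 - 2 * int i))"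
      using ab car by (simp add: scalar_prod_def atLeast0LessThan del: sum.lessThan_Suc)
    also have "\<dots> = (\<Sum>i<Suc k. (if i = a then x b powi (int k - 2 * int a) else 0) +
        (if i = Suc a then - (x k)\<^sup>2 * x b powi (int k - 2 * int (Suc a)) else 0))"
      using ab by (intro sum.cong refl) (auto simp: U_def)
    also have "\<dots> = x b powi (int k - 2 * int a) - (x k)\<^sup>2 * x b powi (int k - 2 * int (Suc a))"
      unfolding sum.distrib using ab by (simp del: sum.lessThan_Suc)
    also have "x b powi (int k - 2 * int a) = x b powi (int k - 1 - 2 * int a) * x b"
      using assms power_int_add_1[of "x b" "int k - 1 - 2 * int a"] by simp
    also have "x b powi (int k - 2 * int (Suc a)) = x b powi (int k - 1 - 2 * int a) / x b"
      using assms power_int_diff[of "x b" "int k - 1 - 2 * int a" 1] by (simp add: algebra_simps)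
    also have "P * u - v\<^sup>2 * (P / u) = v * (u / v - v / u) * P" if "u \<noteq> 0" "v \<noteq> 0" for P u v :: complex
      using that by (simp add: field_simps power2_eq_square)
    note this[OF assms assms]
    finally show ?thesis .
  qed
  have corner: "(U * ?M) $$ (k, k) = x k powi (- int k)"
  proof -
    have "(U * ?M) $$ (k, k) = (\<Sum>i<Suc k. U $$ (k, i) * x k powi (int (Suc k) - 1 - 2 * int i))"
      using car by (simp add: scalar_prod_def atLeast0LessThan del: sum.lessThan_Suc)
    also have "\<dots> = (\<Sum>i<Suc k. if i = k then x k powi (- int k) else 0)"
      by (intro sum.cong refl) (auto simp: U_def)
    finally show ?thesis by simp
  qed
  have "Determinant.det ?M = Determinant.det (U * ?M)"
    using det_mult[OF car] detU by simp
  also have "\<dots> = (\<Sum>i<Suc k. (U * ?M) $$ (i, k) * cofactor (U * ?M) i k)"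
    using car by (intro laplace_expansion_column) auto
  also have "\<dots> = x k powi (- int k) * cofactor (U * ?M) k k"
  proof -
    \<comment> \<open>For \<open>b = k\<close> the difference \<open>x b / x k - x k / x b\<close>
      in \<open>UM\<close> is zero.\<close>
    have "(U * ?M) $$ (i, k) = 0" if "i < k" for i
      unfolding UM[OF that lessI] using assms by simp
    then have "(\<Sum>i<k. (U * ?M) $$ (i, k) * cofactor (U * ?M) i k) = 0"
      by (intro sum.neutral ballI) (simp only: lessThan_iff mult_zero_left)
    then show ?thesis by (simp only: sum.lessThan_Suc corner add_0)
  qed
  also have "cofactor (U * ?M) k k =
      Determinant.det (mat k k (\<lambda>(a, b). (x k * (x b / x k - x k / x b)) * x b powi (int k - 1 - 2 * int a)))"
  proof -
    have "mat_delete (U * ?M) k k =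
        mat k k (\<lambda>(a, b). (x k * (x b / x k - x k / x b)) * x b powi (int k - 1 - 2 * int a))"
      using car UM by (intro eq_matI) (auto simp: mat_delete_def simp del: index_mult_mat(1))
    then show ?thesis by (simp add: cofactor_def mult_2[symmetric])
  qed
  \<comment> \<open>The factor \<open>x k\<close> taken out of each of the \<open>k\<close> columns
    gives \<open>x k ^ k\<close>, which cancels the corner entry
    \<open>x k powi (- int k)\<close>.\<close>
  also have "\<dots> = x k ^ k * (\<Prod>b<k. x b / x k - x k / x b) * (\<Prod>b<k. \<Prod>a<b. x a / x b - x b / x a)"
    unfolding det_column_scale Suc.IH prod.distrib by simp
  finally show ?case using assms by (simp add: power_int_minus mult_ac)
qed

text \<open>The symmetric Vandermonde determinant at points of the unit circle: each difference of
  quotients is \<open>- 2 * \<i>\<close> times a sine.\<close>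

lemma det_equally_spaced_powers:
  assumes m: "m > 0"
  shows "Determinant.det (mat k k (\<lambda>(a, b). (exp (of_real pi * \<i> / of_nat m) powi (int k - 1 - 2 * int a)) ^ f b)) =
    (\<Prod>b<k. \<Prod>a<b. - 2 * \<i> * of_real (sin (pi * (real (f b) - real (f a)) / real m)))"
proof -
  let ?y = "exp (of_real pi * \<i> / of_nat m) :: complex"
  have x: "?y ^ j = exp (\<i> * of_real (pi * real j / real m))" for j
    by (simp add: exp_of_nat_mult[symmetric] mult_ac)
  have d: "?y ^ i / ?y ^ j - ?y ^ j / ?y ^ i = - 2 * \<i> * of_real (sin (pi * (real j - real i) / real m))" for i j
  proof -
    let ?t = "complex_of_real (pi * (real j - real i) / real m)"
    have "?y ^ i / ?y ^ j = exp (- (\<i> * ?t))" "?y ^ j / ?y ^ i = exp (\<i> * ?t)"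
      unfolding x exp_diff[symmetric]
      by (intro arg_cong[of _ _ exp]; simp add: diff_divide_distrib right_diff_distrib)+
    then show ?thesis by (simp add: sin_of_real[symmetric] sin_exp_eq)
  qed
  have "(?y powi (int k - 1 - 2 * int a)) ^ j = (?y ^ j) powi (int k - 1 - 2 * int a)" for a j
    by (simp add: power_int_power power_int_power' mult.commute)
  then have "Determinant.det (mat k k (\<lambda>(a, b). (?y powi (int k - 1 - 2 * int a)) ^ f b)) =
      Determinant.det (mat k k (\<lambda>(a, b). (?y ^ f b) powi (int k - 1 - 2 * int a)))" by simp
  also have "\<dots> = (\<Prod>b<k. \<Prod>a<b. ?y ^ f a / ?y ^ f b - ?y ^ f b / ?y ^ f a)"
    by (rule det_symmetric_vandermonde) simp
  finally show ?thesis unfolding d .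
qed

section \<open>Lines of eigenvector matrices\<close>

lemma continuous_map_row_span:
  fixes F :: "'a :: metric_space \<Rightarrow> complex mat"
  assumes F: "\<And>t. t \<in> S \<Longrightarrow> F t \<in> full_rank_mats k n"
    and cont: "\<And>i j. i < k \<Longrightarrow> j < n \<Longrightarrow> continuous_on S (\<lambda>t. F t $$ (i, j))"
  shows "continuous_map (top_of_set S) (Gr_topology k n) (\<lambda>t. row_span (F t))"
  unfolding continuous_map_def
proof (intro conjI allI impI)
  show "(\<lambda>t. row_span (F t)) \<in> topspace (top_of_set S) \<rightarrow> topspace (Gr_topology k n)"
    using F by (auto simp: topspace_Gr_topology Gr_row_span)
  fix U assume "openin (Gr_topology k n) U"
  then have U: "Gr_open k n U" by (simp add: openin_Gr_topology)
  have "\<exists>d>0. \<forall>s\<in>S. dist s t < d \<longrightarrow> row_span (F s) \<in> U" if t: "t \<in> S" "row_span (F t) \<in> U" for t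
  proof -
    obtain e where e: "e > 0" "\<And>B. B \<in> full_rank_mats k n \<Longrightarrow>
        (\<forall>i<k. \<forall>j<n. dist (B $$ (i, j)) (F t $$ (i, j)) < e) \<Longrightarrow> row_span B \<in> U"
      using U F[OF t(1)] t(2) unfolding Gr_open_def by blast
    have "\<forall>\<^sub>F s in at t within S. dist (F s $$ (i, j)) (F t $$ (i, j)) < e" if "i < k" "j < n" for i j
      using cont[OF that] t(1) e(1) by (intro tendstoD) (auto simp: continuous_on_def)
    \<comment> \<open>There are finitely many entries, so one neighbourhood of \<open>t\<close>
      serves all of them.\<close>
    then have "\<forall>\<^sub>F s in at t within S. \<forall>i\<in>{..<k}. \<forall>j\<in>{..<n}. dist (F s $$ (i, j)) (F t $$ (i, j)) < e"
      by (intro eventually_ball_finite ballI) auto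
    then obtain d where d: "d > 0" "\<And>s. s \<in> S \<Longrightarrow> s \<noteq> t \<Longrightarrow> dist s t < d \<Longrightarrow>
        \<forall>i\<in>{..<k}. \<forall>j\<in>{..<n}. dist (F s $$ (i, j)) (F t $$ (i, j)) < e"
      unfolding eventually_at by blast
    have "row_span (F s) \<in> U" if "s \<in> S" "dist s t < d" for s
    proof (cases "s = t")
      case False
      then show ?thesis using d(2)[OF that(1) _ that(2)] by (intro e(2) F that) auto
    qed (use t in simp)
    then show ?thesis using d(1) by blast
  qed
  then show "openin (top_of_set S) {t \<in> topspace (top_of_set S). row_span (F t) \<in> U}"
    unfolding openin_euclidean_subtopology_iff by auto
qed

text \<open>A property of functions, so that closure rules apply directly to determinants and to
  \<open>eval_poly\<close>; its purpose is the finiteness of zero sets.\<close>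

definition polynomial_map :: "(complex \<Rightarrow> complex) \<Rightarrow> bool" where
  "polynomial_map F \<longleftrightarrow> (\<exists>P. \<forall>t. F t = poly P t)"

lemma polynomial_map_const: "polynomial_map (\<lambda>t. c)"
  unfolding polynomial_map_def by (rule exI[of _ "[:c:]"]) simp

lemma polynomial_map_affine: "polynomial_map (\<lambda>t. (1 - t) * u + t * v)"
  unfolding polynomial_map_def by (rule exI[of _ "[:u, v - u:]"]) (simp add: algebra_simps)

lemma polynomial_map_add: "polynomial_map F \<Longrightarrow> polynomial_map G \<Longrightarrow> polynomial_map (\<lambda>t. F t + G t)"
  unfolding polynomial_map_def by (metis poly_add)

lemma polynomial_map_mult: "polynomial_map F \<Longrightarrow> polynomial_map G \<Longrightarrow> polynomial_map (\<lambda>t. F t * G t)"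
  unfolding polynomial_map_def by (metis poly_mult)

lemma polynomial_map_power: "polynomial_map F \<Longrightarrow> polynomial_map (\<lambda>t. F t ^ m)"
  by (induction m) (simp_all add: polynomial_map_const polynomial_map_mult)

lemma polynomial_map_sum: "(\<And>i. i \<in> S \<Longrightarrow> polynomial_map (F i)) \<Longrightarrow> polynomial_map (\<lambda>t. \<Sum>i\<in>S. F i t)"
  by (induction S rule: infinite_finite_induct) (simp_all add: polynomial_map_const polynomial_map_add)

lemma polynomial_map_prod: "(\<And>i. i \<in> S \<Longrightarrow> polynomial_map (F i)) \<Longrightarrow> polynomial_map (\<lambda>t. \<Prod>i\<in>S. F i t)"
  by (induction S rule: infinite_finite_induct) (simp_all add: polynomial_map_const polynomial_map_mult)

lemma polynomial_map_det:
  assumes "\<And>a b. a < k \<Longrightarrow> b < k \<Longrightarrow> polynomial_map (\<lambda>t. M t a b)"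
  shows "polynomial_map (\<lambda>t. Determinant.det (mat k k (\<lambda>(a, b). M t a b)))"
proof -
  have "polynomial_map (\<lambda>t. \<Sum>q\<in>{q. q permutes {0..<k}}. signof q * (\<Prod>i\<in>{0..<k}. M t i (q i)))"
  proof (intro polynomial_map_sum polynomial_map_mult polynomial_map_const polynomial_map_prod)
    fix q i assume "q \<in> {q. q permutes {0..<k}}" "i \<in> {0..<k}"
    then show "polynomial_map (\<lambda>t. M t i (q i))"
      using permutes_in_image[of q "{0..<k}" i] by (intro assms) auto
  qed
  moreover have "Determinant.det (mat k k (\<lambda>(a, b). M t a b)) =
      (\<Sum>q\<in>{q. q permutes {0..<k}}. signof q * (\<Prod>i\<in>{0..<k}. M t i (q i)))" for t
  proof -
    have "mat k k (\<lambda>(a, b). M t a b) $$ (i, q i) = M t i (q i)"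
      if "q permutes {0..<k}" "i \<in> {0..<k}" for q i
      using that permutes_in_image[of q "{0..<k}" i] by simp
    then show ?thesis
      by (subst det_def'[of _ k]) (auto intro!: sum.cong prod.cong)
  qed
  ultimately show ?thesis by (simp only:)
qed

lemma polynomial_map_zeros:
  assumes "polynomial_map F" "F s \<noteq> 0"
  shows "finite {t. F t = 0}"
proof -
  obtain P where P: "\<And>t. F t = poly P t" using assms(1) by (auto simp: polynomial_map_def)
  then have "P \<noteq> 0" using assms(2) by auto
  then show ?thesis unfolding P by (rule poly_roots_finite)
qed

text \<open>The parameter is complex: the line stays connected after removal of finitely many
  points.\<close>

definition segment :: "complex mat \<Rightarrow> complex mat \<Rightarrow> complex \<Rightarrow> complex mat" where
  "segment W W' t = mat (dim_row W) (dim_col W) (\<lambda>(a, j). (1 - t) * W $$ (a, j) + t * W' $$ (a, j))"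

lemma polynomial_map_eval_segment:
  assumes W: "W \<in> carrier_mat k n" and f: "f \<in> carrier (plucker_poly_ring k n)"
  shows "polynomial_map (\<lambda>t. eval_poly (plucker (segment W W' t)) f)"
  unfolding eval_poly_def
proof (intro polynomial_map_sum polynomial_map_mult polynomial_map_const polynomial_map_prod polynomial_map_power)
  fix m I assume "m \<in> Poly_Mapping.keys f" "I \<in> Poly_Mapping.keys m"
  then have I: "I \<in> index_sets k n" using f unfolding carrier_plucker_poly_ring by blast
  obtain g where g: "strict_mono_on {..<k} g" "\<And>b. b < k \<Longrightarrow> g b < n" "I = (\<lambda>b. Suc (g b)) ` {..<k}"
    using index_set_enum[OF I] by metis
  have "plucker (segment W W' t) I = Determinant.det (mat k k (\<lambda>(a, b). segment W W' t $$ (a, g b)))" for t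
  proof -
    have "segment W W' t \<in> carrier_mat k n" using W by (simp add: segment_def)
    then show ?thesis unfolding g(3) by (rule plucker_image[OF _ g(1,2)])
  qed
  moreover have "polynomial_map (\<lambda>t. Determinant.det (mat k k (\<lambda>(a, b). segment W W' t $$ (a, g b))))"
    using W g(2) by (intro polynomial_map_det) (simp add: segment_def polynomial_map_affine)
  ultimately show "polynomial_map (\<lambda>t. plucker (segment W W' t) I)" by (simp only:)
qed

section \<open>Joining eigenvector matrices inside a component, and the nonnegative point\<close>

context equally_spaced
begin

lemma segment_ends:
  assumes "W \<in> carrier_mat k n" "W' \<in> carrier_mat k n"
  shows "segment W W' 0 = W" "segment W W' 1 = W'"
  using assms by (auto simp: segment_def intro!: eq_matI)

text \<open>Row \<open>a\<close> stays in the eigenspace of \<open>zeta a\<close> all along the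
  line, so only a zero row can spoil the property; that forces an affine function which is nonzero
  at \<open>t = 0\<close> to vanish.\<close>

lemma finite_not_eigenmat_segment:
  assumes W: "eigenmat W" and W': "eigenmat W'"
  shows "finite {t. \<not> eigenmat (segment W W' t)}"
proof -
  have car: "W \<in> carrier_mat k n" "W' \<in> carrier_mat k n" using W W' by (auto simp: eigenmat_def)
  have S: "segment W W' t \<in> carrier_mat k n" for t using car by (simp add: segment_def)
  have u: "unroll k (row (segment W W' t) a) j = (1 - t) * unroll k (row W a) j + t * unroll k (row W' a) j"
    if "a < k" for a t j
    using that car n_pos by (simp add: unroll_def segment_def algebra_simps)
  have ev: "eigenvec k l (zeta a) (row (segment W W' t) a)" if "a < k" for a t
    using W W' that by (simp add: eigenvec_def eigenmat_def u algebra_simps)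
  have fin: "finite {t. row (segment W W' t) a = 0\<^sub>v n}" if a: "a < k" for a
  proof -
    have r: "row W a \<in> carrier_vec n" using row_carrier[of W a] car by simp
    obtain j where j: "unroll k (row W a) j \<noteq> 0"
      using W a unroll_eq_0_iff[OF r n_pos, of k] by (auto simp: eigenmat_def)
    have "finite {t. (1 - t) * unroll k (row W a) j + t * unroll k (row W' a) j = 0}"
      using j by (intro polynomial_map_zeros[where s = 0] polynomial_map_affine) simp
    moreover have "{t. row (segment W W' t) a = 0\<^sub>v n} \<subseteq>
        {t. (1 - t) * unroll k (row W a) j + t * unroll k (row W' a) j = 0}"
    proof clarify
      fix t assume "row (segment W W' t) a = 0\<^sub>v n"
      then have "unroll k (row (segment W W' t) a) j = 0" using n_pos by (simp add: unroll_def)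
      then show "(1 - t) * unroll k (row W a) j + t * unroll k (row W' a) j = 0"
        unfolding u[OF a] .
    qed
    ultimately show ?thesis by (rule finite_subset[rotated])
  qed
  have "{t. \<not> eigenmat (segment W W' t)} \<subseteq> (\<Union>a<k. {t. row (segment W W' t) a = 0\<^sub>v n})"
    using S ev by (auto simp: eigenmat_def)
  then show ?thesis by (rule finite_subset) (use fin in auto)
qed

text \<open>The punctured line from \<open>W\<close> to \<open>W'\<close> has connected image in the
  fixed locus and meets \<open>D\<close> at \<open>t = 0\<close>, so all of it lies in
  \<open>D\<close>.\<close>

lemma component_contains_eigenmats:
  assumes D: "D \<in> connected_components_of (subtopology (Gr_topology k n) (fixed_locus k n l))"
    and W: "eigenmat W" "row_span W \<in> D" and W': "eigenmat W'"
  shows "row_span W' \<in> D"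
proof -
  have car: "W \<in> carrier_mat k n" "W' \<in> carrier_mat k n" using W W' by (auto simp: eigenmat_def)
  let ?S = "- {t. \<not> eigenmat (segment W W' t)}"
  have "connected ?S"
    using connected_open_delete_finite[of UNIV "{t. \<not> eigenmat (segment W W' t)}"]
      finite_not_eigenmat_segment[OF W(1) W'] by (simp add: Compl_eq_Diff_UNIV convex_connected)
  then have "connectedin (top_of_set ?S) ?S"
    by (simp add: connectedin_subtopology)
  moreover have "continuous_map (top_of_set ?S) (Gr_topology k n) (\<lambda>t. row_span (segment W W' t))"
  proof (rule continuous_map_row_span)
    show "segment W W' t \<in> full_rank_mats k n" if "t \<in> ?S" for t
      using that by (simp add: eigenmat_full_rank)
    show "continuous_on ?S (\<lambda>t. segment W W' t $$ (i, j))" if "i < k" "j < n" for i j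
      using that car by (simp add: segment_def) (intro continuous_intros)
  qed
  ultimately have "connectedin (Gr_topology k n) ((\<lambda>t. row_span (segment W W' t)) ` ?S)"
    by (rule connectedin_continuous_map_image[rotated])
  moreover have "(\<lambda>t. row_span (segment W W' t)) ` ?S \<subseteq> fixed_locus k n l"
    by (auto simp: eigenmat_fixed_locus)
  ultimately have con: "connectedin (subtopology (Gr_topology k n) (fixed_locus k n l))
      ((\<lambda>t. row_span (segment W W' t)) ` ?S)"
    by (simp add: connectedin_subtopology)
  have im: "row_span W \<in> (\<lambda>t. row_span (segment W W' t)) ` ?S" "row_span W' \<in> (\<lambda>t. row_span (segment W W' t)) ` ?S"
    using W W' segment_ends[OF car] by (auto intro: image_eqI[of _ _ 0] image_eqI[of _ _ 1])
  have "\<not> disjnt D ((\<lambda>t. row_span (segment W W' t)) ` ?S)"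
    using im(1) W(2) by (auto simp: disjnt_iff)
  then have "(\<lambda>t. row_span (segment W W' t)) ` ?S \<subseteq> D"
    by (rule connected_components_of_maximal[OF D con])
  then show ?thesis using im(2) by blast
qed

text \<open>Both points are replaced by eigenvector matrices with the same Plucker coordinates. On
  the line joining these, \<open>f\<close> and \<open>g\<close> are polynomials in \<open>t\<close>,
  nonzero at \<open>t = 0\<close> and \<open>t = 1\<close> respectively, so all but finitely many
  parameters give a common point.\<close>

lemma primeideal_component:
  assumes D: "D \<in> connected_components_of (subtopology (Gr_topology k n) (fixed_locus k n l))"
    and W0: "eigenmat W0" "row_span W0 \<in> D"
  shows "primeideal (vanishing_ideal k n D) (plucker_poly_ring k n)"
proof (rule primeideal_vanishing_ideal[OF eigenmat_full_rank[OF W0(1)] W0(2)])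
  fix A B f g
  assume A: "A \<in> full_rank_mats k n" "row_span A \<in> D" and B: "B \<in> full_rank_mats k n" "row_span B \<in> D"
    and f: "f \<in> carrier (plucker_poly_ring k n)" and g: "g \<in> carrier (plucker_poly_ring k n)"
    and nz: "eval_poly (plucker A) f \<noteq> 0" "eval_poly (plucker B) g \<noteq> 0"
  obtain W where W: "eigenmat W" "\<And>I. I \<in> index_sets k n \<Longrightarrow> plucker W I = plucker A I"
    using eigenmat_of_eigenvecs[OF A(1) component_has_eigenvecs[OF D W0 A(2)]] by blast
  obtain W' where W': "eigenmat W'" "\<And>I. I \<in> index_sets k n \<Longrightarrow> plucker W' I = plucker B I"
    using eigenmat_of_eigenvecs[OF B(1) component_has_eigenvecs[OF D W0 B(2)]] by blast
  have car: "W \<in> carrier_mat k n" "W' \<in> carrier_mat k n" using W W' by (auto simp: eigenmat_def)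
  let ?F = "\<lambda>t. eval_poly (plucker (segment W W' t)) f" and ?G = "\<lambda>t. eval_poly (plucker (segment W W' t)) g"
  have "?F 0 \<noteq> 0" "?G 1 \<noteq> 0"
    using nz eval_poly_cong[OF f W(2)] eval_poly_cong[OF g W'(2)] by (simp_all add: segment_ends[OF car])
  then have "finite {t. ?F t = 0}" "finite {t. ?G t = 0}"
    using polynomial_map_zeros[OF polynomial_map_eval_segment[OF car(1) f]]
      polynomial_map_zeros[OF polynomial_map_eval_segment[OF car(1) g]] by blast+
  then have fin: "finite ({t. \<not> eigenmat (segment W W' t)} \<union> {t. ?F t = 0} \<union> {t. ?G t = 0})"
    using finite_not_eigenmat_segment[OF W(1) W'(1)] by blast
  obtain t where "t \<notin> {t. \<not> eigenmat (segment W W' t)} \<union> {t. ?F t = 0} \<union> {t. ?G t = 0}"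
    using ex_new_if_finite[OF infinite_UNIV_char_0 fin] by (rule exE)
  then have t: "eigenmat (segment W W' t)" "?F t \<noteq> 0" "?G t \<noteq> 0" by simp_all
  show "\<exists>C\<in>full_rank_mats k n. row_span C \<in> D \<and> eval_poly (plucker C) f \<noteq> 0 \<and> eval_poly (plucker C) g \<noteq> 0"
    using eigenmat_full_rank[OF t(1)] component_contains_eigenmats[OF D W0 t(1)] t(2,3) by (intro bexI conjI)
qed

text \<open>The cyclically symmetric totally positive point, written as a matrix of eigenvectors.\<close>

definition karp :: "complex mat" where
  "karp = mat k n (\<lambda>(a, j). (exp (of_real pi * \<i> / of_nat n) powi (int k - 1 - 2 * int a)) ^ j)"

lemma karp_carrier: "karp \<in> carrier_mat k n"
  by (simp add: karp_def)

text \<open>The \<open>n\<close>-th power of the ratio is \<open>(-1) ^ (k - 1)\<close>, so the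
  geometric progression continues itself across each turn.\<close>

lemma unroll_karp:
  assumes "a < k"
  shows "unroll k (row karp a) j = (exp (of_real pi * \<i> / of_nat n) powi (int k - 1 - 2 * int a)) ^ j"
proof -
  let ?z = "exp (of_real pi * \<i> / of_nat n) powi (int k - 1 - 2 * int a) :: complex"
  have "row karp a = Matrix.vec n (\<lambda>j. ?z ^ j)"
    using assms by (intro eq_vecI) (simp_all add: karp_def)
  moreover have "?z ^ (j + n) = (-1) ^ (k - 1) * ?z ^ j" for j
    using root_of_sign[OF n_pos, of k a] k by (simp add: power_add)
  ultimately show ?thesis using unroll_vec[of "\<lambda>j. ?z ^ j" n k j] n_pos by simp
qed

lemma eigenmat_karp: "eigenmat karp"
  unfolding eigenmat_def
proof (intro conjI allI impI)
  show "karp \<in> carrier_mat k n" by (rule karp_carrier)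
  fix a assume a: "a < k"
  have "row karp a \<in> carrier_vec n" using row_carrier[of karp a] karp_carrier by simp
  then show "row karp a \<noteq> 0\<^sub>v n"
    using unroll_eq_0_iff[of "row karp a" n k] unroll_karp[OF a, of 0] n_pos by auto
  have "exp (of_real pi * \<i> / of_nat n) ^ l = \<omega>"
    using l by (simp add: exp_of_nat_mult[symmetric] n)
  then have "(exp (of_real pi * \<i> / of_nat n) powi (int k - 1 - 2 * int a)) ^ l = zeta a"
    unfolding zeta_def by (metis mult.commute power_int_mult power_int_of_nat)
  then show "eigenvec k l (zeta a) (row karp a)"
    by (simp add: eigenvec_def unroll_karp[OF a] power_add mult.commute)
qed

lemma karp_sin_pos: "i < j \<Longrightarrow> j < n \<Longrightarrow> 0 < sin (pi * (real j - real i) / real n)"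
proof -
  assume ij: "i < j" "j < n"
  have "real j - real i < real n" using ij by simp
  then have "pi * (real j - real i) / real n < pi" using n_pos by (simp add: divide_less_eq)
  moreover have "0 < pi * (real j - real i) / real n" using ij n_pos by simp
  ultimately show ?thesis by (rule sin_gt_zero[rotated])
qed

text \<open>Every Plucker coordinate is the same constant \<open>c\<close>, one factor
  \<open>- 2 * \<i>\<close> per pair of columns, times a product of sines of angles strictly between
  \<open>0\<close> and \<open>pi\<close>.\<close>

lemma karp_nonneg: "row_span karp \<in> Gr_nonneg k n"
proof -
  define c :: complex where "c = (\<Prod>b<k. \<Prod>a<b. - 2 * \<i>)"
  have c: "c \<noteq> 0" by (simp add: c_def)
  have "inverse c * plucker karp I \<in> \<real>\<^sub>\<ge>\<^sub>0" if I: "I \<in> index_sets k n" for I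
  proof -
    obtain f where f: "strict_mono_on {..<k} f" "\<And>b. b < k \<Longrightarrow> f b < n" "I = (\<lambda>b. Suc (f b)) ` {..<k}"
      using index_set_enum[OF I] by metis
    let ?s = "\<lambda>a b. sin (pi * (real (f b) - real (f a)) / real n)"
    have "mat k k (\<lambda>(a, b). karp $$ (a, f b)) =
        mat k k (\<lambda>(a, b). (exp (of_real pi * \<i> / of_nat n) powi (int k - 1 - 2 * int a)) ^ f b)"
      using f(2) by (intro eq_matI) (auto simp: karp_def)
    then have "plucker karp I = (\<Prod>b<k. \<Prod>a<b. - 2 * \<i> * of_real (?s a b))"
      using plucker_image[OF karp_carrier f(1,2)] det_equally_spaced_powers[OF n_pos, of k f] f(3) by simp
    then have "plucker karp I = c * of_real (\<Prod>b<k. \<Prod>a<b. ?s a b)"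
      by (simp only: c_def of_real_prod prod.distrib)
    then have "inverse c * plucker karp I = of_real (\<Prod>b<k. \<Prod>a<b. ?s a b)" using c by simp
    moreover have "0 \<le> (\<Prod>b<k. \<Prod>a<b. ?s a b)"
    proof (intro prod_nonneg ballI)
      fix b a assume "b \<in> {..<k}" "a \<in> {..<b}"
      then show "0 \<le> ?s a b"
        using f(2)[of b] strict_mono_onD[OF f(1), of a b] by (intro less_imp_le karp_sin_pos) auto
    qed
    ultimately show ?thesis by (simp only: nonneg_Reals_of_real_iff)
  qed
  moreover have "inverse c \<noteq> 0" using c by simp
  ultimately show ?thesis
    unfolding Gr_nonneg_def using eigenmat_full_rank[OF eigenmat_karp] by blast
qed

text \<open>Witnesses that the denominator does not vanish identically on \<open>D\<close>.\<close>

lemma minor_karp: "minor k karp \<noteq> 0"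
proof -
  have "minor k karp = Determinant.det (mat k k (\<lambda>(a, b).
      (exp (of_real pi * \<i> / of_nat n) powi (int k - 1 - 2 * int a)) ^ (b * l)))"
    unfolding minor_def by (intro arg_cong[of _ _ Determinant.det] eq_matI) (simp_all add: unroll_karp skip_def)
  also have "\<dots> = (\<Prod>b<k. \<Prod>a<b. - 2 * \<i> * of_real (sin (pi * (real (b * l) - real (a * l)) / real n)))"
    by (rule det_equally_spaced_powers[OF n_pos])
  also have "\<dots> \<noteq> 0"
  proof -
    have "sin (pi * (real (b * l) - real (a * l)) / real n) \<noteq> 0" if "b < k" "a < b" for a b
    proof -
      have "a * l < b * l" "b * l < n" using that l p unfolding n by simp_all
      then show ?thesis using karp_sin_pos[of "a * l" "b * l"] by simp
    qed
    then show ?thesis by (simp add: prod_zero_iff del: of_nat_mult)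
  qed
  finally show ?thesis .
qed

lemma card_T_single: "s \<le> k \<Longrightarrow> card (T_single k l s) = k"
  unfolding T_single_eq using l strict_mono_skip[of s]
  by (subst card_image) (auto simp: inj_on_def strict_mono_eq)

end

section \<open>The ratio of Plucker coordinates on the nonnegative component\<close>

theorem lemma7p16:
  fixes k l n p s :: nat and D :: "complex Matrix.vec set set"
  assumes "k \<ge> 2" and "l \<ge> 2" and "n = p * l" and "p \<ge> k"
    and "is_nonneg_component n k l D"
    and "s \<in> {1..k}"
  shows "coord_class k n D (plucker_var n (T_empty k l)) \<noteq> \<zero>\<^bsub>coord_ring k n D\<^esub> \<and>
    to_frac (coord_ring k n D) (coord_class k n D (plucker_var n (T_single k l s)))
      \<otimes>\<^bsub>fraction_field (coord_ring k n D)\<^esub>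
    inv\<^bsub>fraction_field (coord_ring k n D)\<^esub>
      to_frac (coord_ring k n D) (coord_class k n D (plucker_var n (T_empty k l))) =
    to_frac (coord_ring k n D) (coord_class k n D (const_poly
      (eval_fls (q_binomial k s) (exp (of_real pi * \<i> / of_nat p)))))"
proof -
  interpret equally_spaced k l n p using assms(1-4) by unfold_locales auto
  have s: "1 \<le> s" "s \<le> k" using assms(6) by auto
  have D: "D \<in> connected_components_of (subtopology (Gr_topology k n) (fixed_locus k n l))"
    and nonneg: "fixed_locus k n l \<inter> Gr_nonneg k n \<subseteq> D"
    using assms(5) by (auto simp: is_nonneg_component_def)
  \<comment> \<open>The only use of nonnegativity: it identifies \<open>D\<close> as the component
    with the spectrum \<open>zeta\<close>.\<close>
  have karp: "row_span karp \<in> D"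
    using nonneg eigenmat_fixed_locus[OF eigenmat_karp] karp_nonneg by blast
  have T: "plucker_var n (T_single k l t) \<in> carrier (plucker_poly_ring k n)" if "t \<le> k" for t
    using that by (intro plucker_var_carrier n_pos card_T_single)
  show ?thesis
    unfolding T_empty_eq
  proof (rule coord_ring_ratio[OF primeideal_component[OF D eigenmat_karp karp]])
    show "plucker_var n (T_single k l s) \<in> carrier (plucker_poly_ring k n)"
      "plucker_var n (T_single k l k) \<in> carrier (plucker_poly_ring k n)" using T s by auto
    show "karp \<in> full_rank_mats k n" by (rule eigenmat_full_rank[OF eigenmat_karp])
    show "row_span karp \<in> D" by (rule karp)
    show "eval_poly (plucker karp) (plucker_var n (T_single k l k)) \<noteq> 0"
      using eval_T_single[OF karp_carrier, of k] k minor_karp by simp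
    fix A assume A: "A \<in> full_rank_mats k n" "row_span A \<in> D"
    \<comment> \<open>Every point of \<open>D\<close> has all the eigenvalues of the symmetric
      point, so its Plucker coordinates are those of an eigenvector matrix, to which
      \<open>eigenmat_minor\<close> applies.\<close>
    obtain W where W: "eigenmat W" "\<And>I. I \<in> index_sets k n \<Longrightarrow> plucker W I = plucker A I"
      using eigenmat_of_eigenvecs[OF A(1) component_has_eigenvecs[OF D eigenmat_karp karp A(2)]] by blast
    have car: "W \<in> carrier_mat k n" using W(1) by (simp add: eigenmat_def)
    have "eval_poly (plucker A) (plucker_var n (T_single k l t)) = minor t W" if "1 \<le> t" "t \<le> k" for t
      using eval_poly_cong[OF T[OF that(2)] W(2)] eval_T_single[OF car that] by simp
    then show "eval_poly (plucker A) (plucker_var n (T_single k l s)) =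
        eval_fls (q_binomial k s) \<omega> * eval_poly (plucker A) (plucker_var n (T_single k l k))"
      using eigenmat_minor[OF W(1) s(2)] s k by simp
  qed
qed

end
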